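(* Let $p$ be an odd prime and let $n=2^\nu p^r n'$, where $\nu>0$ and $r\geq 0$ are integers and $n'$ is an odd positive integer with $p\nmid n'$. Let $l$ be a positive integer. Then the number $NE(p^l,n)$ of Euclidean self-dual negacyclic codes of length $n$ over $\mathbb{F}_{p^l}$ is \[ NE(p^l,n)=\begin{cases}(p^r+1)^{\frac{1}{2}\sum_{d\mid n'}\frac{\phi(d2^{\nu+1})}{\operatorname{ord}_{d2^{\nu+1}}(p^l)}} & \text{if } 2^{\nu+1}\nmid (p^l+1),\\ 0 & \text{otherwise.}\end{cases} \]
   Context: A linear code of length $n$ over a finite field $\mathbb{F}_q$ is an $\mathbb{F}_q$-subspace of $\mathbb{F}_q^n$. It is negacyclic if $(-c_{n-1},c_0,c_1,\dots,c_{n-2})\in C$ whenever $(c_0,c_1,\dots,c_{n-1})\in C$. The Euclidean dual of $C$ is $C^{\perp_E}=\{v\in\mathbb{F}_q^n : \sum_{i=1}^n v_ic_i=0 \text{ for all } c\in C\}$, and $C$ is Euclidean self-dual if $C=C^{\perp_E}$. $\phi$ is Euler's totient function and $\operatorname{ord}_m(x)$ is the multiplicative order of $x$ modulo $m$. *)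

theory Defs
  imports Complex_Main "HOL-Number_Theory.Number_Theory"
begin

text \<open>Vectors of length n over a field are modelled as functions nat => 'a that vanish
  outside the index set {0..<n}; coordinate i corresponds to c_i.\<close>

definition vecs :: "nat \<Rightarrow> (nat \<Rightarrow> 'a::zero) set" where
  "vecs n = {v. \<forall>i\<ge>n. v i = 0}"

definition linear_code :: "nat \<Rightarrow> (nat \<Rightarrow> 'a::field) set \<Rightarrow> bool" where
  "linear_code n C \<longleftrightarrow> C \<subseteq> vecs n \<and> (\<lambda>_. 0) \<in> C \<and>
     (\<forall>u\<in>C. \<forall>v\<in>C. (\<lambda>i. u i + v i) \<in> C) \<and>
     (\<forall>a. \<forall>u\<in>C. (\<lambda>i. a * u i) \<in> C)"

definition negashift :: "nat \<Rightarrow> (nat \<Rightarrow> 'a::ring_1) \<Rightarrow> nat \<Rightarrow> 'a" where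
  "negashift n c = (\<lambda>i. if i = 0 then - c (n - 1) else if i < n then c (i - 1) else 0)"

definition negacyclic :: "nat \<Rightarrow> (nat \<Rightarrow> 'a::field) set \<Rightarrow> bool" where
  "negacyclic n C \<longleftrightarrow> (\<forall>c\<in>C. negashift n c \<in> C)"

definition euclid_dual :: "nat \<Rightarrow> (nat \<Rightarrow> 'a::field) set \<Rightarrow> (nat \<Rightarrow> 'a) set" where
  "euclid_dual n C = {v \<in> vecs n. \<forall>c\<in>C. (\<Sum>i<n. v i * c i) = 0}"

definition euclid_self_dual :: "nat \<Rightarrow> (nat \<Rightarrow> 'a::field) set \<Rightarrow> bool" where
  "euclid_self_dual n C \<longleftrightarrow> C = euclid_dual n C"

definition NE :: "'a::{field,finite} itself \<Rightarrow> nat \<Rightarrow> nat" where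
  "NE _ n = card {C :: (nat \<Rightarrow> 'a) set. linear_code n C \<and> negacyclic n C \<and> euclid_self_dual n C}"

end

theory Submission
  imports "HOL-Algebra.Algebraic_Closure_Type" Defs
begin

text \<open>
  Negacyclic codes of length \<open>n = m p^r\<close> correspond to monic divisors \<open>g\<close> of
  \<open>x^n + 1 = (x^m + 1)^(p^r)\<close>. Over the algebraic closure such a divisor is the function sending each
  of the simple roots of \<open>x^m + 1\<close> to its multiplicity in \<open>g\<close>, a number between \<open>0\<close> and \<open>p^r\<close>; the
  functions that occur are exactly those invariant under the Frobenius map \<open>x \<mapsto> x^q\<close>, \<open>q = p^l\<close>.
  Taking the dual code replaces \<open>e\<close> by \<open>x \<mapsto> p^r - e(1/x)\<close>. Self-dual codes are thus the functions
  on Frobenius orbits with \<open>e(1/x) = p^r - e(x)\<close>. If inversion fixes an orbit there is none, since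
  \<open>p^r\<close> is odd; otherwise the values on one orbit of each inverse pair can be chosen freely.
  The roots of \<open>x^m + 1\<close> are the elements of multiplicative order \<open>d 2^(\<nu>+1)\<close> with \<open>d\<close> dividing
  \<open>n'\<close>; those of order \<open>N\<close> number \<open>\<phi>(N)\<close> and form orbits of size \<open>ord_N(q)\<close>. Inversion fixes an orbit
  iff \<open>q^k\<close> is \<open>-1\<close> modulo some such order, which forces \<open>k\<close> odd and hence \<open>2^(\<nu>+1)\<close> to divide
  \<open>q + 1\<close>.
\<close>

subsection \<open>Polynomials and the algebraic closure\<close>

text \<open>Multiplication by a nonzero \<open>a\<close> permutes the nonzero elements, so it
  preserves their product while scaling it by \<open>a ^ card S\<close>.\<close>

lemma finite_field_power_card:
  fixes a :: "'a::{field,finite}"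
  shows "a ^ card (UNIV :: 'a set) = a"
proof (cases "a = 0")
  case True
  then show ?thesis
    by (simp add: power_0_left)
next
  case False
  define S where "S = (UNIV :: 'a set) - {0}"
  have fin: "finite S" by simp
  have "bij_betw (\<lambda>x. a * x) S S"
    by (rule bij_betwI[where g = "\<lambda>x. x / a"]) (use False in \<open>auto simp: S_def\<close>)
  then have "(\<Prod>x\<in>S. a * x) = \<Prod>S"
    by (rule prod.reindex_bij_betw)
  then have "a ^ card S * \<Prod>S = \<Prod>S"
    by (simp add: prod.distrib)
  moreover have "\<Prod>S \<noteq> 0"
    by (simp add: S_def)
  ultimately have "a ^ card S = 1"
    by simp
  moreover have "card (UNIV :: 'a set) = Suc (card S)"
    unfolding S_def by (metis card.remove finite UNIV_I)
  ultimately show ?thesis by simp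
qed

text \<open>The homomorphism laws are explicit premises here and below, so that the same rules serve
  the embedding \<open>to_ac\<close> and the Frobenius power maps.\<close>

lemma map_poly_hom_add:
  assumes "f 0 = 0" "\<And>x y. f (x + y) = f x + f y"
  shows "map_poly f (A + B) = map_poly f A + map_poly f B"
  by (rule poly_eqI) (simp add: coeff_map_poly assms)

lemma map_poly_hom_mult:
  fixes f :: "'a::comm_semiring_0 \<Rightarrow> 'b::comm_semiring_0"
  assumes "f 0 = 0" "\<And>x y. f (x + y) = f x + f y" "\<And>x y. f (x * y) = f x * f y"
  shows "map_poly f (A * B) = map_poly f A * map_poly f B"
proof (induction A)
  case (pCons a A)
  then show ?case
    by (simp add: map_poly_pCons map_poly_hom_add map_poly_smult assms)
qed simp

lemma map_poly_hom_prod: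
  fixes f :: "'a::comm_semiring_1 \<Rightarrow> 'b::comm_semiring_1"
  assumes "f 0 = 0" "f 1 = 1" "\<And>x y. f (x + y) = f x + f y" "\<And>x y. f (x * y) = f x * f y"
  shows "map_poly f (prod g S) = (\<Prod>x\<in>S. map_poly f (g x))"
  by (induction S rule: infinite_finite_induct) (simp_all add: map_poly_hom_mult assms)

lemma map_poly_hom_power:
  fixes f :: "'a::comm_semiring_1 \<Rightarrow> 'b::comm_semiring_1"
  assumes "f 0 = 0" "f 1 = 1" "\<And>x y. f (x + y) = f x + f y" "\<And>x y. f (x * y) = f x * f y"
  shows "map_poly f (A ^ k) = map_poly f A ^ k"
  by (induction k) (simp_all add: map_poly_hom_mult assms)

text \<open>Over an algebraically closed field a nonconstant \<open>A\<close> has a root, which then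
  has positive order in \<open>B\<close> as well. Induction peels off this common linear
  factor.\<close>

lemma dvd_iff_order_le:
  fixes A B :: "'a::alg_closed_field poly"
  assumes "A \<noteq> 0" "B \<noteq> 0"
  shows "A dvd B \<longleftrightarrow> (\<forall>x. Polynomial.order x A \<le> Polynomial.order x B)"
proof
  assume "A dvd B"
  then show "\<forall>x. Polynomial.order x A \<le> Polynomial.order x B"
    using assms dvd_imp_order_le by blast
next
  assume "\<forall>x. Polynomial.order x A \<le> Polynomial.order x B"
  with assms show "A dvd B"
  proof (induction "degree A" arbitrary: A B)
    case 0
    then show ?case
      by (metis is_unit_iff_degree unit_imp_dvd)
  next
    case (Suc k)
    then obtain x where x: "poly A x = 0"
      using alg_closed_imp_poly_has_root[of A] by auto
    then obtain A' where A': "A = [:-x, 1:] * A'"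
      by (metis dvdE poly_eq_0_iff_dvd)
    have "poly B x = 0"
      using Suc.prems x by (metis le_zero_eq order_root)
    then obtain B' where B': "B = [:-x, 1:] * B'"
      by (metis dvdE poly_eq_0_iff_dvd)
    have "A' dvd B'"
    proof (rule Suc.hyps(1))
      have "A' \<noteq> 0" using A' Suc.prems by auto
      then show "k = degree A'"
        using Suc.hyps(2) A' by (simp add: degree_mult_eq del: mult_pCons_left)
      show "\<forall>y. Polynomial.order y A' \<le> Polynomial.order y B'"
      proof
        fix y
        show "Polynomial.order y A' \<le> Polynomial.order y B'"
          using Suc.prems(3)[rule_format, of y] Suc.prems(1,2)
          unfolding A' B' by (metis add_le_cancel_left order_mult)
      qed
    qed (use A' B' Suc.prems in auto)
    then show ?case
      unfolding A' B' by (rule mult_dvd_mono[OF dvd_refl])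
  qed
qed

lemma map_poly_to_ac_mult:
  "map_poly to_ac (A * B) = map_poly to_ac A * map_poly to_ac B"
  by (rule map_poly_hom_mult) simp_all

lemma degree_map_poly_to_ac [simp]: "degree (map_poly to_ac A) = degree A"
  by (rule degree_map_poly) simp_all

lemma map_poly_to_ac_eq_0_iff [simp]: "map_poly to_ac A = 0 \<longleftrightarrow> A = 0"
  by (rule map_poly_eq_0_iff) simp_all

text \<open>Divisibility descends from the closure: the remainder of \<open>B\<close> by
  \<open>A\<close> is still divisible by \<open>A\<close> there, but its degree is too small for it
  to be nonzero.\<close>

lemma map_poly_to_ac_dvd_iff:
  "map_poly to_ac A dvd map_poly to_ac B \<longleftrightarrow> A dvd B"
proof
  assume "A dvd B"
  then show "map_poly to_ac A dvd map_poly to_ac B"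
    by (auto simp: map_poly_to_ac_mult)
next
  assume dvd: "map_poly to_ac A dvd map_poly to_ac B"
  have "map_poly to_ac B = map_poly to_ac A * map_poly to_ac (B div A) + map_poly to_ac (B mod A)"
    using map_poly_hom_add[of to_ac "A * (B div A)" "B mod A"] by (simp add: map_poly_to_ac_mult)
  with dvd have *: "map_poly to_ac A dvd map_poly to_ac (B mod A)"
    by (metis dvd_add_times_triv_left_iff mult.commute)
  have "B mod A = 0"
  proof (rule ccontr)
    assume nz: "B mod A \<noteq> 0"
    with * have "degree A \<le> degree (B mod A)"
      using dvd_imp_degree_le[OF *] by simp
    moreover have "A \<noteq> 0"
      using nz dvd by auto
    ultimately show False
      using degree_mod_less[of A B] nz by auto
  qed
  then show "A dvd B" by auto
qed

text \<open>Reflection is multiplicative and turns the linear factor with root \<open>1 / x\<close>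
  into a scalar multiple of the one with root \<open>x\<close>.\<close>

lemma order_reflect_poly_ge:
  fixes A :: "'a::field poly"
  assumes "A \<noteq> 0" "x \<noteq> 0"
  shows "Polynomial.order (1 / x) A \<le> Polynomial.order x (reflect_poly A)"
proof -
  define k where "k = Polynomial.order (1 / x) A"
  obtain B where B: "A = [:- (1 / x), 1:] ^ k * B"
    unfolding k_def using order_1[of "1 / x" A] by blast
  have "reflect_poly [:- (1 / x), 1:] = smult (- (1 / x)) [:- x, 1:]"
    using assms by (intro poly_eqI)
      (auto simp: coeff_reflect_poly coeff_pCons split: nat.splits)
  then have "reflect_poly A = [:- x, 1:] ^ k * smult ((- (1 / x)) ^ k) (reflect_poly B)"
    unfolding B reflect_poly_mult reflect_poly_power
    by (simp only: smult_power mult_smult_left mult_smult_right)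
  then have "[:- x, 1:] ^ k dvd reflect_poly A"
    by (metis dvd_triv_left)
  then show ?thesis
    using assms by (simp add: order_divides k_def)
qed

text \<open>The missing inequality is the previous one applied to the reflected polynomial at
  \<open>1 / x\<close>. Reflecting twice returns a polynomial only if its constant coefficient is
  nonzero, so a power of the variable is split off first.\<close>

lemma order_reflect_poly:
  fixes A :: "'a::field poly"
  assumes "A \<noteq> 0" "x \<noteq> 0"
  shows "Polynomial.order x (reflect_poly A) = Polynomial.order (1 / x) A"
proof (rule antisym[OF _ order_reflect_poly_ge[OF assms]])
  define j where "j = Polynomial.order 0 A"
  obtain B where "A = [:- 0, 1:] ^ j * B" "\<not> [:- 0, 1:] dvd B"
    unfolding j_def using order_decomp[OF assms(1)] by blast
  then have B: "A = monom 1 j * B" "poly.coeff B 0 \<noteq> 0"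
    by (simp_all add: monom_altdef dvd_iff_poly_eq_0 poly_0_coeff_0)
  have "Polynomial.order (1 / x) (monom 1 j :: 'a poly) = 0"
    using assms by (intro order_0I) (simp add: poly_monom)
  moreover have "reflect_poly (monom 1 j :: 'a poly) = 1"
    by (intro poly_eqI) (auto simp: coeff_reflect_poly degree_monom_eq)
  moreover have "B \<noteq> 0" using B by auto
  ultimately show "Polynomial.order x (reflect_poly A) \<le> Polynomial.order (1 / x) A"
    using order_reflect_poly_ge[of "reflect_poly B" "1 / x"] assms B
    by (simp add: reflect_poly_mult order_mult)
qed

subsection \<open>Negacyclic codes and divisors of \<open>x^n + 1\<close>\<close>

text \<open>When \<open>g\<close> divides \<open>x^n + 1\<close>, this is the ideal generated by
  \<open>g\<close> in the quotient by \<open>x^n + 1\<close>, each class being represented by its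
  remainder.\<close>

definition poly_code :: "nat \<Rightarrow> 'a::field poly \<Rightarrow> (nat \<Rightarrow> 'a) set" where
  "poly_code n g = poly.coeff ` {f. degree f < n \<and> g dvd f}"

lemma coeff_in_poly_code_iff: "poly.coeff f \<in> poly_code n g \<longleftrightarrow> degree f < n \<and> g dvd f"
  by (auto simp: poly_code_def coeff_inject)

lemma coeff_in_vecs_iff:
  assumes "n > 0"
  shows "poly.coeff f \<in> vecs n \<longleftrightarrow> degree f < n"
proof
  assume f: "poly.coeff f \<in> vecs n"
  show "degree f < n"
  proof (cases "f = 0")
    case False
    then have "poly.coeff f (degree f) \<noteq> 0" by simp
    with f show ?thesis unfolding vecs_def by (metis (mono_tags, lifting) mem_Collect_eq not_le)
  qed (use assms in simp)
qed (auto simp: vecs_def coeff_eq_0)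

lemma vecs_obtain_poly:
  assumes "v \<in> vecs n" "n > 0"
  obtains f where "v = poly.coeff f" "degree f < n"
proof -
  have "\<forall>\<^sub>\<infinity>i. v i = 0"
    using assms unfolding vecs_def MOST_nat_le by auto
  then have "v = poly.coeff (Abs_poly v)"
    by (simp add: Abs_poly_inverse)
  then show ?thesis
    using that[of "Abs_poly v"] assms coeff_in_vecs_iff[of n "Abs_poly v"] by simp
qed

definition negacyclic_modulus :: "nat \<Rightarrow> 'a::comm_ring_1 poly" where
  "negacyclic_modulus n = monom 1 n + 1"

lemma coeff_negacyclic_modulus:
  "poly.coeff (negacyclic_modulus n) i = (if i = n then 1 else 0) + (if i = 0 then 1 else 0)"
  by (simp add: negacyclic_modulus_def)

lemma degree_negacyclic_modulus:
  assumes "n > 0"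
  shows "degree (negacyclic_modulus n :: 'a::comm_ring_1 poly) = n"
  using assms unfolding negacyclic_modulus_def
  by (subst degree_add_eq_left) (simp_all add: degree_monom_eq)

lemma monic_negacyclic_modulus:
  assumes "n > 0"
  shows "lead_coeff (negacyclic_modulus n :: 'a::comm_ring_1 poly) = 1"
  using assms by (simp add: degree_negacyclic_modulus coeff_negacyclic_modulus)

lemma negacyclic_modulus_nonzero:
  assumes "n > 0"
  shows "negacyclic_modulus n \<noteq> (0 :: 'a::comm_ring_1 poly)"
  using monic_negacyclic_modulus[OF assms, where ?'a = 'a] by auto

lemma degree_mod_negacyclic_modulus:
  assumes "n > 0"
  shows "degree (f mod negacyclic_modulus n :: 'a::field poly) < n"
  using degree_mod_less'[of "negacyclic_modulus n" f] negacyclic_modulus_nonzero[OF assms, where ?'a = 'a]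
    degree_negacyclic_modulus[OF assms, where ?'a = 'a] assms
  by (cases "f mod negacyclic_modulus n = 0") auto

lemma mod_negacyclic_modulus_eq:
  assumes "degree f < n"
  shows "f mod negacyclic_modulus n = (f :: 'a::field poly)"
  using assms degree_negacyclic_modulus[of n, where ?'a = 'a] by (intro mod_poly_less) simp

text \<open>The negacyclic shift is multiplication by the variable modulo \<open>x^n + 1\<close>:
  removing the overflow \<open>c x^n\<close> subtracts \<open>c\<close> from the constant
  term.\<close>

lemma negashift_coeff:
  fixes f :: "'a::field poly"
  assumes "degree f < n"
  shows "negashift n (poly.coeff f) = poly.coeff (pCons 0 f mod negacyclic_modulus n)"
proof -
  define c where "c = poly.coeff f (n - 1)"
  define R where "R = pCons 0 f - smult c (negacyclic_modulus n)"
  have n: "n > 0" using assms by simp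
  have coeff_R: "poly.coeff R i = negashift n (poly.coeff f) i" for i
    using assms n
    by (cases i) (auto simp: R_def c_def negashift_def coeff_negacyclic_modulus coeff_eq_0)
  have "negashift n (poly.coeff f) \<in> vecs n"
    using n by (auto simp: vecs_def negashift_def)
  then have "degree R < n"
    using coeff_in_vecs_iff[OF n, of R] coeff_R by (metis ext)
  then have "R = R mod negacyclic_modulus n"
    by (simp add: mod_negacyclic_modulus_eq)
  also have "\<dots> = pCons 0 f mod negacyclic_modulus n"
    unfolding R_def by (simp add: poly_mod_diff_left mod_smult_left)
  finally show ?thesis
    using coeff_R by (metis ext)
qed

lemma linear_code_poly_code:
  assumes "n > 0"
  shows "linear_code n (poly_code n g)"
  unfolding linear_code_def
proof (intro conjI ballI allI)
  show "poly_code n g \<subseteq> vecs n"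
    using assms by (auto simp: poly_code_def coeff_in_vecs_iff)
  show "(\<lambda>_. 0) \<in> poly_code n g"
    using assms coeff_in_poly_code_iff[of 0 n g] by (simp add: zero_poly.rep_eq)
next
  fix u v assume "u \<in> poly_code n g" "v \<in> poly_code n g"
  then obtain f h where "u = poly.coeff f" "v = poly.coeff h" "degree f < n" "g dvd f"
    "degree h < n" "g dvd h"
    by (auto simp: poly_code_def)
  then show "(\<lambda>i. u i + v i) \<in> poly_code n g"
    using coeff_in_poly_code_iff[of "f + h" n g] by (simp add: degree_add_less plus_poly.rep_eq)
next
  fix a u assume "u \<in> poly_code n g"
  then obtain f where "u = poly.coeff f" "degree f < n" "g dvd f"
    by (auto simp: poly_code_def)
  then show "(\<lambda>i. a * u i) \<in> poly_code n g"
    using coeff_in_poly_code_iff[of "smult a f" n g]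
    by (simp add: smult.rep_eq dvd_smult le_less_trans[OF degree_smult_le])
qed

lemma negacyclic_poly_code:
  assumes "n > 0" "g dvd negacyclic_modulus n"
  shows "negacyclic n (poly_code n g)"
  unfolding negacyclic_def
proof
  fix v assume "v \<in> poly_code n g"
  then obtain f where f: "v = poly.coeff f" "degree f < n" "g dvd f"
    by (auto simp: poly_code_def)
  have "g dvd pCons 0 f mod negacyclic_modulus n"
    using f(3) assms(2) by (metis dvd_mod dvd_mult mult_pCons_left mult.left_neutral
        smult_0_left add_0 one_pCons)
  then show "negashift n v \<in> poly_code n g"
    using f assms by (simp add: negashift_coeff coeff_in_poly_code_iff degree_mod_negacyclic_modulus)
qed

lemma monic_dvd_antisym:
  fixes g h :: "'a::field poly"
  assumes "g dvd h" "h dvd g" "lead_coeff g = 1" "lead_coeff h = 1"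
  shows "g = h"
proof -
  obtain c where c: "h = g * c" using assms(1) by blast
  have nz: "g \<noteq> 0" "h \<noteq> 0" using assms by auto
  then have "degree g = degree h"
    using assms by (intro antisym dvd_imp_degree_le)
  then have "degree c = 0"
    using c nz by (auto simp: degree_mult_eq)
  then obtain a where a: "c = [:a:]" by (rule degree_eq_zeroE)
  have "lead_coeff h = lead_coeff g * lead_coeff c"
    unfolding c by (rule lead_coeff_mult)
  then have "a = 1"
    unfolding a using assms by simp
  then show ?thesis
    using c a by simp
qed

lemma poly_code_inject:
  assumes "n > 0" "g dvd negacyclic_modulus n" "h dvd negacyclic_modulus n"
    and "lead_coeff g = 1" "lead_coeff h = 1" and eq: "poly_code n g = poly_code n h"
  shows "g = h"
proof -
  have *: "a dvd b"
    if "poly_code n a = poly_code n b" "a dvd negacyclic_modulus n" "b dvd negacyclic_modulus n" for a b :: "'a poly"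
  proof -
    \<comment> \<open>\<open>b\<close> may be the modulus itself, of degree \<open>n\<close>, and
      then is not represented in its own code; its remainder always is.\<close>
    have "poly.coeff (b mod negacyclic_modulus n) \<in> poly_code n b"
      using that assms(1) by (simp add: coeff_in_poly_code_iff degree_mod_negacyclic_modulus dvd_mod)
    then have "a dvd b mod negacyclic_modulus n"
      using that by (metis coeff_in_poly_code_iff)
    then show ?thesis
      using that(2) by (simp add: dvd_mod_iff)
  qed
  have dvd: "g dvd h" "h dvd g"
    using * assms by metis+
  show ?thesis
    by (rule monic_dvd_antisym) fact+
qed

text \<open>The polynomials whose remainder modulo \<open>x^n + 1\<close> lies in the code form an ideal,
  and a monic element of least degree generates it.\<close>

lemma negacyclic_code_is_poly_code:
  fixes C :: "(nat \<Rightarrow> 'a::field) set"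
  assumes n: "n > 0" and lin: "linear_code n C" and neg: "negacyclic n C"
  obtains g where "lead_coeff g = 1" "g dvd negacyclic_modulus n" "C = poly_code n g"
proof -
  define M :: "'a poly" where "M = negacyclic_modulus n"
  define I where "I = {f. poly.coeff (f mod M) \<in> C}"
  have zero: "0 \<in> I" and MI: "M \<in> I"
    using lin by (simp_all add: I_def linear_code_def zero_poly.rep_eq)
  have add: "f + h \<in> I" if "f \<in> I" "h \<in> I" for f h
    using that lin by (simp add: I_def linear_code_def poly_mod_add_left plus_poly.rep_eq)
  have smult: "smult a f \<in> I" if "f \<in> I" for a f
    using that lin by (simp add: I_def linear_code_def mod_smult_left smult.rep_eq)
  have shift: "pCons 0 f \<in> I" if "f \<in> I" for f
  proof -
    have "pCons 0 f mod M = pCons 0 (f mod M) mod M"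
      using mod_mult_right_eq[of "[:0, 1:]" f M] by simp
    then have "poly.coeff (pCons 0 f mod M) = negashift n (poly.coeff (f mod M))"
      using n by (simp add: negashift_coeff M_def degree_mod_negacyclic_modulus)
    then show ?thesis
      using that neg by (simp add: I_def negacyclic_def)
  qed
  have mult: "a * f \<in> I" if "f \<in> I" for a f
  proof (induction a)
    case (pCons c a)
    then show ?case
      using add smult shift that by simp
  qed (use zero in simp)
  define P where "P = (\<lambda>f. f \<in> I \<and> f \<noteq> 0)"
  \<comment> \<open>The modulus lies in the ideal even when the code is zero, so a nonzero element
    of least degree exists; the zero code gets the generator \<open>x^n + 1\<close>.\<close>
  have "P M" using MI negacyclic_modulus_nonzero[OF n] by (simp add: P_def M_def)
  define g0 where "g0 = arg_min degree P"
  have g0: "P g0" and g0_min: "\<And>f. P f \<Longrightarrow> degree g0 \<le> degree f"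
    using arg_min_nat_lemma[of P M degree] \<open>P M\<close> by (auto simp: g0_def)
  define g where "g = smult (inverse (lead_coeff g0)) g0"
  have g: "g \<in> I" "lead_coeff g = 1" "degree g = degree g0"
    using g0 smult by (auto simp: g_def P_def)
  have gnz: "g \<noteq> 0" using g by auto
  have dvd: "g dvd f" if "f \<in> I" for f
  proof -
    have "f mod g = f + smult (- 1) ((f div g) * g)"
      by (simp add: minus_div_mult_eq_mod [symmetric])
    then have "f mod g \<in> I"
      using that g mult add smult by metis
    then have "f mod g = 0"
      using g0_min[of "f mod g"] degree_mod_less'[OF gnz, of f] g(3) by (fastforce simp: P_def)
    then show ?thesis by auto
  qed
  show ?thesis
  proof
    show "lead_coeff g = 1" by fact
    show "g dvd negacyclic_modulus n"
      using dvd[OF MI] by (simp add: M_def)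
    show "C = poly_code n g"
    proof (intro equalityI subsetI)
      fix v assume v: "v \<in> C"
      then have "v \<in> vecs n" using lin by (auto simp: linear_code_def)
      then obtain f where f: "v = poly.coeff f" "degree f < n"
        using n vecs_obtain_poly by blast
      then have "f \<in> I"
        using v by (simp add: I_def M_def mod_negacyclic_modulus_eq)
      then show "v \<in> poly_code n g"
        using f dvd by (simp add: coeff_in_poly_code_iff)
    next
      fix v assume "v \<in> poly_code n g"
      then obtain f where f: "v = poly.coeff f" "degree f < n" "g dvd f"
        by (auto simp: poly_code_def)
      then have "f \<in> I"
        using mult g(1) by (metis dvdE mult.commute)
      then show "v \<in> C"
        using f by (simp add: I_def M_def mod_negacyclic_modulus_eq)
    qed
  qed
qed

subsection \<open>The dual of a negacyclic code\<close>

text \<open>\<open>reflect_poly\<close> reverses only up to the degree; the monomial pads the result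
  so that, for degree below \<open>n\<close>, all \<open>n\<close> coordinates are reversed.\<close>

definition rev_poly :: "nat \<Rightarrow> 'a::field poly \<Rightarrow> 'a poly" where
  "rev_poly n f = monom 1 (n - 1 - degree f) * reflect_poly f"

lemma coeff_rev_poly:
  assumes "degree f < n"
  shows "poly.coeff (rev_poly n f) i = (if i < n then poly.coeff f (n - 1 - i) else 0)"
proof -
  have "degree f < n - Suc i" if "i < n - Suc (degree f)"
    using that assms by linarith
  then show ?thesis
    using assms unfolding rev_poly_def
    by (auto simp: coeff_monom_mult coeff_reflect_poly coeff_eq_0 Suc_diff_Suc le_diff_conv intro!: arg_cong[of _ _ "poly.coeff f"])
qed

lemma degree_rev_poly_less:
  assumes "degree f < n"
  shows "degree (rev_poly n f) < n"
  using assms by (intro degree_lessI) (auto simp: coeff_rev_poly)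

lemma rev_poly_eq_0_iff [simp]: "rev_poly n f = 0 \<longleftrightarrow> f = 0"
  by (simp add: rev_poly_def)

lemma sum_coeff_eq_coeff_rev_poly_mult:
  assumes "degree f < n"
  shows "(\<Sum>i<n. poly.coeff f i * poly.coeff c i) = poly.coeff (rev_poly n f * c) (n - 1)"
proof -
  have n: "n > 0" using assms by simp
  have "poly.coeff (rev_poly n f * c) (n - 1) =
      (\<Sum>i\<le>n - 1. poly.coeff (rev_poly n f) i * poly.coeff c (n - 1 - i))"
    by (simp add: coeff_mult)
  also have "\<dots> = (\<Sum>i<n. poly.coeff (rev_poly n f) i * poly.coeff c (n - 1 - i))"
    using n by (intro sum.cong) auto
  also have "\<dots> = (\<Sum>i<n. poly.coeff f (n - Suc i) * poly.coeff c (n - Suc i))"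
    using assms by (intro sum.cong) (auto simp: coeff_rev_poly)
  also have "\<dots> = (\<Sum>i<n. poly.coeff f i * poly.coeff c i)"
    by (rule sum.nat_diff_reindex)
  finally show ?thesis by simp
qed

text \<open>The degree bound is that of a product of two polynomials of degree below
  \<open>n\<close>. A nonzero quotient then has degree at most \<open>n - 2\<close>, so reducing
  \<open>x^n\<close> to \<open>-1\<close> cannot reach position \<open>n - 1\<close>.\<close>

lemma coeff_mod_negacyclic_modulus:
  fixes A :: "'a::field poly"
  assumes "degree A \<le> 2 * n - 2" "n > 0"
  shows "poly.coeff (A mod negacyclic_modulus n) (n - 1) = poly.coeff A (n - 1)"
proof -
  define M :: "'a poly" where "M = negacyclic_modulus n"
  define w where "w = A div M"
  have M: "M \<noteq> 0" "degree M = n"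
    using assms by (simp_all add: M_def negacyclic_modulus_nonzero degree_negacyclic_modulus)
  have wM: "poly.coeff (w * M) (n - 1) = poly.coeff w (n - 1)"
    using assms by (simp add: M_def negacyclic_modulus_def distrib_right mult.commute[of w] coeff_monom_mult)
  have "poly.coeff w (n - 1) = 0"
  proof (cases "w = 0")
    case False
    have "degree A = degree (w * M)"
    proof -
      have "degree (A mod M) < degree (w * M)"
        using False M degree_mod_negacyclic_modulus[OF assms(2), of A]
        by (simp add: degree_mult_eq M_def)
      then have "degree (w * M + A mod M) = degree (w * M)"
        by (rule degree_add_eq_left)
      then show ?thesis by (simp add: w_def)
    qed
    then have "degree w + n \<le> 2 * n - 2"
      using assms False M by (simp add: degree_mult_eq)
    then show ?thesis
      using assms by (intro coeff_eq_0) linarith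
  qed simp
  then have "poly.coeff (w * M + A mod M) (n - 1) = poly.coeff (A mod M) (n - 1)"
    using wM by simp
  then show ?thesis by (simp add: w_def M_def)
qed

text \<open>The inner product with \<open>f\<close> is the coefficient of \<open>x^(n-1)\<close> in a product with the reversed
  polynomial. The linear functional reading off this coefficient modulo \<open>x^n + 1\<close> vanishes on no
  nonzero ideal, so orthogonality to all multiples of \<open>g\<close> is divisibility of
  \<open>rev_poly n f * g\<close> by \<open>x^n + 1\<close>.\<close>

lemma mem_euclid_dual_poly_code_iff:
  fixes f g h :: "'a::field poly"
  assumes n: "n > 0" and gh: "g * h = negacyclic_modulus n" and f: "degree f < n"
  shows "poly.coeff f \<in> euclid_dual n (poly_code n g) \<longleftrightarrow> h dvd rev_poly n f"
proof -
  define M :: "'a poly" where "M = negacyclic_modulus n"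
  define F where "F = rev_poly n f"
  have M: "M \<noteq> 0" using n by (simp add: M_def negacyclic_modulus_nonzero)
  have gnz: "g \<noteq> 0" using gh M by (auto simp: M_def)
  have inner: "(\<Sum>i<n. poly.coeff f i * poly.coeff c i) = poly.coeff (F * c mod M) (n - 1)"
    if "degree c < n" for c
  proof -
    have "degree (F * c) \<le> degree F + degree c" by (rule degree_mult_le)
    then have "degree (F * c) \<le> 2 * n - 2"
      using that degree_rev_poly_less[OF f] unfolding F_def by linarith
    then show ?thesis
      using n f unfolding F_def M_def
      by (simp only: sum_coeff_eq_coeff_rev_poly_mult coeff_mod_negacyclic_modulus)
  qed
  have "poly.coeff f \<in> euclid_dual n (poly_code n g) \<longleftrightarrow>
      (\<forall>c. degree c < n \<and> g dvd c \<longrightarrow> poly.coeff (F * c mod M) (n - 1) = 0)"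
    using n f inner by (auto simp: euclid_dual_def coeff_in_vecs_iff poly_code_def)
  also have "\<dots> \<longleftrightarrow> M dvd F * g"
  proof
    assume "M dvd F * g"
    then have "M dvd F * c" if "g dvd c" for c
      using that by (meson dvd_trans mult_dvd_mono dvd_refl)
    then show "\<forall>c. degree c < n \<and> g dvd c \<longrightarrow> poly.coeff (F * c mod M) (n - 1) = 0"
      by (simp add: mod_eq_0_iff_dvd)
  next
    assume *: "\<forall>c. degree c < n \<and> g dvd c \<longrightarrow> poly.coeff (F * c mod M) (n - 1) = 0"
    define W where "W = F * g mod M"
    have "W = 0"
    proof (rule ccontr)
      assume W: "W \<noteq> 0"
      have deg: "degree W < n"
        using n by (simp add: W_def M_def degree_mod_negacyclic_modulus)
      \<comment> \<open>Multiplying by this monomial moves the leading coefficient of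
        \<open>W\<close> to position \<open>n - 1\<close>, exactly where the functional
        reads.\<close>
      define Q :: "'a poly" where "Q = monom 1 (n - 1 - degree W)"
      have degWQ: "degree (W * Q) = n - 1"
        using W deg by (simp add: Q_def degree_mult_eq degree_monom_eq)
      have "g dvd g * Q mod M"
        unfolding M_def gh[symmetric] by (intro dvd_mod) simp_all
      then have "poly.coeff (F * (g * Q mod M) mod M) (n - 1) = 0"
        using * n by (simp add: M_def degree_mod_negacyclic_modulus)
      also have "F * (g * Q mod M) mod M = W * Q mod M"
        by (simp add: W_def mod_mult_right_eq mod_mult_left_eq mult.assoc)
      also have "\<dots> = W * Q"
        using degWQ n by (simp add: M_def mod_negacyclic_modulus_eq)
      finally have "lead_coeff (W * Q) = 0" using degWQ by simp
      then show False using W by (simp add: Q_def)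
    qed
    then show "M dvd F * g" by (simp add: W_def mod_eq_0_iff_dvd)
  qed
  also have "\<dots> \<longleftrightarrow> h dvd F"
    using gh gnz by (simp add: M_def mult.commute[of F] flip: gh)
  finally show ?thesis by (simp add: F_def)
qed

text \<open>The padding monomial vanishes at most at 0, so at a nonzero point the order comes from
  the reflected factor alone.\<close>

lemma order_map_poly_rev_poly:
  assumes "f \<noteq> 0" "x \<noteq> 0"
  shows "Polynomial.order x (map_poly to_ac (rev_poly n f)) = Polynomial.order (1 / x) (map_poly to_ac f)"
proof -
  have "map_poly to_ac (reflect_poly f) = reflect_poly (map_poly to_ac f)"
    by (intro poly_eqI) (simp add: coeff_map_poly coeff_reflect_poly)
  moreover have "Polynomial.order x (monom 1 k :: 'a alg_closure poly) = 0" for k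
    using assms by (intro order_0I) (simp add: poly_monom)
  ultimately show ?thesis
    using assms by (simp add: rev_poly_def map_poly_to_ac_mult map_poly_monom order_mult order_reflect_poly)
qed

subsection \<open>Multiplicities of roots\<close>

lemma poly_map_poly_hom:
  fixes f :: "'a::comm_semiring_1 \<Rightarrow> 'b::comm_semiring_1"
  assumes "f 0 = 0" "\<And>x y. f (x + y) = f x + f y" "\<And>x y. f (x * y) = f x * f y"
  shows "poly (map_poly f A) (f x) = f (poly A x)"
  by (induction A) (simp_all add: map_poly_pCons assms)

lemma order_eqI:
  fixes A B :: "'a::idom poly"
  assumes "A = [:-x, 1:] ^ k * B" "poly B x \<noteq> 0"
  shows "Polynomial.order x A = k"
proof -
  have "[:-x, 1:] ^ k \<noteq> 0" "B \<noteq> 0" using assms by auto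
  then show ?thesis
    unfolding assms(1) by (subst order_mult) (auto simp: order_power_n_n order_0I assms(2))
qed

text \<open>An injective homomorphism carries the factorization of \<open>A\<close> at
  \<open>x\<close> to one at \<open>f x\<close>, and the cofactor stays nonzero there. It is applied
  to the Frobenius map.\<close>

lemma order_map_poly_hom:
  fixes f :: "'a::idom \<Rightarrow> 'b::idom"
  assumes "f 0 = 0" "f 1 = 1" "\<And>x y. f (x + y) = f x + f y" "\<And>x y. f (x * y) = f x * f y"
    and "\<And>x. f x = 0 \<Longrightarrow> x = 0" and "A \<noteq> 0"
  shows "Polynomial.order (f x) (map_poly f A) = Polynomial.order x A"
proof -
  define k where "k = Polynomial.order x A"
  obtain B where B: "A = [:-x, 1:] ^ k * B" "\<not> [:-x, 1:] dvd B"
    unfolding k_def using order_decomp[OF assms(6)] by blast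
  have "f x + f (- x) = 0"
    using assms(1) assms(3)[of x "- x"] by simp
  then have neg: "f (- x) = - f x"
    by (simp add: eq_neg_iff_add_eq_0 add.commute)
  show ?thesis
    unfolding k_def[symmetric]
  proof (rule order_eqI)
    show "map_poly f A = [:- f x, 1:] ^ k * map_poly f B"
      using assms neg by (simp add: B(1) map_poly_hom_mult map_poly_hom_power map_poly_pCons)
    show "poly (map_poly f B) (f x) \<noteq> 0"
      using assms(1,3,4) assms(5)[of "poly B x"] B(2) by (auto simp: poly_map_poly_hom poly_eq_0_iff_dvd)
  qed
qed

lemma order_power:
  fixes A :: "'a::idom poly"
  assumes "A \<noteq> 0"
  shows "Polynomial.order x (A ^ k) = k * Polynomial.order x A"
  using assms by (induction k) (simp_all add: order_mult)

lemma order_prod_linear: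
  fixes S :: "'a::idom set"
  assumes "finite S"
  shows "Polynomial.order y (\<Prod>x\<in>S. [:-x, 1:] ^ e x) = (if y \<in> S then e y else 0)"
  using assms
proof (induction S)
  case (insert x S)
  have nz: "[:-x, 1:] ^ e x * (\<Prod>x\<in>S. [:-x, 1:] ^ e x) \<noteq> 0"
    using insert.hyps by (simp add: prod_zero_iff)
  have "Polynomial.order y ([:-x, 1:] ^ e x) = (if y = x then e x else 0)"
    by (auto simp: order_power_n_n intro!: order_0I)
  then show ?case
    using insert nz by (auto simp: order_mult)
qed simp

lemma order_simple_root:
  fixes A :: "'a::idom poly"
  assumes "poly A x = 0" "poly (pderiv A) x \<noteq> 0"
  shows "Polynomial.order x A = 1"
proof -
  obtain B where B: "A = [:-x, 1:] * B"
    using assms(1) by (metis dvdE poly_eq_0_iff_dvd)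
  have "poly B x \<noteq> 0"
    using assms(2) unfolding B pderiv_mult by (simp add: pderiv_pCons)
  then show ?thesis
    by (intro order_eqI[of _ _ _ B]) (simp_all add: B)
qed

text \<open>Every root being simple, \<open>A\<close> divides the product of the linear factors at
  its distinct roots; comparing degrees bounds the degree by the number of roots.\<close>

lemma card_simple_roots:
  fixes A :: "'a::alg_closed_field poly"
  assumes "A \<noteq> 0" "\<And>x. poly A x = 0 \<Longrightarrow> poly (pderiv A) x \<noteq> 0"
  shows "card {x. poly A x = 0} = degree A"
proof (rule antisym[OF card_poly_roots_bound[OF assms(1)]])
  define S where "S = {x. poly A x = 0}"
  have fin: "finite S" using poly_roots_finite[OF assms(1)] by (simp add: S_def)
  define G where "G = (\<Prod>x\<in>S. [:-x, 1:] ^ 1)"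
  have G: "G \<noteq> 0" using fin by (simp add: G_def prod_zero_iff)
  have "A dvd G"
  proof (subst dvd_iff_order_le[OF assms(1) G], rule allI)
    fix x
    show "Polynomial.order x A \<le> Polynomial.order x G"
      using order_simple_root[of A x] assms order_0I[of A x] unfolding G_def order_prod_linear[OF fin]
      by (auto simp: S_def)
  qed
  then have "degree A \<le> degree G" using G by (rule dvd_imp_degree_le)
  also have "degree G = card S"
    unfolding G_def by (subst degree_prod_eq_sum_degree) auto
  finally show "degree A \<le> card {x. poly A x = 0}" by (simp add: S_def)
qed

section \<open>Divisors of x^n + 1 over a finite field and their root multiplicities\<close>

locale negacyclic_length =
  fixes field_type :: "'a::{field,finite} itself" and p l r m n :: nat
  assumes prime_p: "prime p" and odd_p: "odd p" and card_field: "card (UNIV :: 'a set) = p ^ l"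
    and m_pos: "m > 0" and p_m: "\<not> p dvd m" and n_eq: "n = m * p ^ r"
begin

lemma n_pos: "n > 0"
  using m_pos prime_p by (simp add: n_eq prime_gt_0_nat)

lemma CHAR_field: "CHAR('a) = p"
proof -
  have "prime CHAR('a)"
    by (intro prime_CHAR_semidom finite_imp_CHAR_pos) simp
  moreover have "CHAR('a) dvd p ^ l"
    using CHAR_dvd_CARD[where ?'a = 'a] card_field by simp
  ultimately show ?thesis
    using prime_p by (metis prime_dvd_power primes_dvd_imp_eq)
qed

lemma frobenius_add:
  "(x + y :: 'a alg_closure) ^ (p ^ k) = x ^ (p ^ k) + y ^ (p ^ k)"
  using prime_p by (intro freshmans_dream') (simp_all add: CHAR_field)

lemma frobenius_inject:
  assumes "x ^ (p ^ k) = (y :: 'a alg_closure) ^ (p ^ k)"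
  shows "x = y"
proof -
  have "x ^ (p ^ k) = y ^ (p ^ k) + (x - y) ^ (p ^ k)"
    using frobenius_add[of y "x - y" k] by simp
  then show ?thesis using assms by simp
qed

lemma of_nat_eq_0_iff: "(of_nat k :: 'a alg_closure) = 0 \<longleftrightarrow> p dvd k"
  by (simp add: of_nat_eq_0_iff_char_dvd CHAR_field)

text \<open>The fixed points are the roots of \<open>X^q - X\<close>, at most \<open>q\<close> of
  them, and the \<open>q\<close> elements of the base field are already among them.\<close>

lemma frobenius_fixed_iff:
  "(x :: 'a alg_closure) ^ (p ^ l) = x \<longleftrightarrow> x \<in> range to_ac"
proof -
  define q where "q = p ^ l"
  have "card {0, 1 :: 'a} \<le> card (UNIV :: 'a set)" by (intro card_mono) auto
  then have q: "q > 1" using card_field by (simp add: q_def)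
  define A :: "'a alg_closure poly" where "A = monom 1 q - monom 1 1"
  have "poly.coeff A q = 1" using q by (simp add: A_def)
  then have A: "A \<noteq> 0" by auto
  have "degree A \<le> q" unfolding A_def using q by (intro degree_diff_le) (auto simp: degree_monom_eq)
  then have le: "card {x. poly A x = 0} \<le> q" using card_poly_roots_bound[OF A] by simp
  have sub: "range (to_ac :: 'a \<Rightarrow> _) \<subseteq> {x. poly A x = 0}"
  proof safe
    fix a :: 'a
    have "to_ac a ^ q = to_ac (a ^ q)" by simp
    also have "a ^ q = a" using finite_field_power_card[of a] by (simp add: q_def card_field)
    finally show "poly A (to_ac a) = 0" by (simp add: A_def poly_monom)
  qed
  have "card (range (to_ac :: 'a \<Rightarrow> _)) = q"
    using card_image[OF inj_to_ac[where ?'a = 'a]] card_field by (simp add: q_def)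
  then have "range (to_ac :: 'a \<Rightarrow> _) = {x. poly A x = 0}"
    using le sub poly_roots_finite[OF A] by (intro card_seteq) auto
  then show ?thesis by (auto simp: A_def poly_monom q_def)
qed

definition roots :: "'a alg_closure set" where
  "roots = {x. x ^ m = - 1}"

lemma roots_eq: "roots = {x. poly (negacyclic_modulus m) x = 0}"
  by (auto simp: roots_def negacyclic_modulus_def poly_monom eq_neg_iff_add_eq_0)

lemma finite_roots: "finite roots"
  unfolding roots_eq by (intro poly_roots_finite negacyclic_modulus_nonzero m_pos)

lemma roots_nonzero: "x \<in> roots \<Longrightarrow> x \<noteq> 0"
  using m_pos by (auto simp: roots_def power_0_left)

lemma inverse_in_roots: "x \<in> roots \<Longrightarrow> 1 / x \<in> roots"
  by (simp add: roots_def power_divide)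

lemma ball_inverse_roots: "(\<forall>x\<in>roots. P x (1 / x)) \<longleftrightarrow> (\<forall>x\<in>roots. P (1 / x) x)"
proof -
  have "P x (1 / x)" if "\<forall>x\<in>roots. P (1 / x) x" "x \<in> roots"
    for P :: "'a alg_closure \<Rightarrow> 'a alg_closure \<Rightarrow> bool" and x
    using bspec[OF that(1) inverse_in_roots[OF that(2)]] by simp
  from this[of P] this[of "\<lambda>x y. P y x"] show ?thesis by blast
qed

text \<open>The exponent \<open>p ^ k\<close> is odd, so it fixes -1.\<close>

lemma frobenius_in_roots: "x \<in> roots \<Longrightarrow> x ^ (p ^ k) \<in> roots"
  using odd_p by (simp add: roots_def power_mult[symmetric] mult.commute[of _ m]) (simp add: power_mult)

lemma bij_frobenius_roots: "bij_betw (\<lambda>x. x ^ (p ^ k)) roots roots"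
proof -
  have "inj_on (\<lambda>x. x ^ (p ^ k)) roots"
    by (auto intro: inj_onI frobenius_inject)
  then show ?thesis
    using endo_inj_surj[OF finite_roots, of "\<lambda>x. x ^ (p ^ k)"] frobenius_in_roots
    by (auto simp: bij_betw_def)
qed

lemma map_poly_modulus: "map_poly to_ac (negacyclic_modulus n) = (negacyclic_modulus n :: 'a alg_closure poly)"
  by (rule poly_eqI) (simp add: coeff_map_poly coeff_negacyclic_modulus)

lemma negacyclic_modulus_factor:
  "(negacyclic_modulus n :: 'a alg_closure poly) = negacyclic_modulus m ^ (p ^ r)"
proof -
  have char: "CHAR('a alg_closure poly) = p"
    by (simp add: CHAR_field)
  have "(monom 1 m + 1 :: 'a alg_closure poly) ^ (p ^ r) = monom 1 m ^ (p ^ r) + 1 ^ (p ^ r)"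
    using prime_p by (intro freshmans_dream'[where n = r]) (simp_all only: char)
  then show ?thesis by (simp add: negacyclic_modulus_def monom_power n_eq)
qed

text \<open>The derivative of \<open>x^m + 1\<close> is nonzero at the roots because
  \<open>p\<close> does not divide \<open>m\<close>; hence they are simple, and
  \<open>x^n + 1\<close> is the \<open>p ^ r\<close>-th power of \<open>x^m + 1\<close>.\<close>

lemma order_modulus:
  "Polynomial.order x (map_poly to_ac (negacyclic_modulus n :: 'a poly)) = (if x \<in> roots then p ^ r else 0)"
proof -
  have "Polynomial.order x (negacyclic_modulus m) = (if x \<in> roots then 1 else 0)"
  proof (cases "x \<in> roots")
    case True
    have "poly (pderiv (negacyclic_modulus m)) x \<noteq> 0"
      using p_m True roots_nonzero
      by (simp add: negacyclic_modulus_def pderiv_add pderiv_monom poly_monom of_nat_eq_0_iff)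
    then show ?thesis
      using True by (simp add: order_simple_root roots_eq)
  next
    case False
    then show ?thesis by (simp add: order_0I roots_eq)
  qed
  then show ?thesis
    using m_pos by (simp add: map_poly_modulus negacyclic_modulus_factor order_power negacyclic_modulus_nonzero)
qed

definition divisors :: "'a poly set" where
  "divisors = {g. lead_coeff g = 1 \<and> g dvd negacyclic_modulus n}"

text \<open>The restriction makes the function extensional, so that equality means equal
  multiplicities on \<open>roots\<close> and the functions form a subset of a finite
  \<open>\<rightarrow>\<^sub>E\<close> space.\<close>

definition exponents :: "'a poly \<Rightarrow> 'a alg_closure \<Rightarrow> nat" where
  "exponents g = (\<lambda>x\<in>roots. Polynomial.order x (map_poly to_ac g))"

definition exponent_functions :: "('a alg_closure \<Rightarrow> nat) set" where
  "exponent_functions = {e \<in> roots \<rightarrow>\<^sub>E {0..p ^ r}. \<forall>x\<in>roots. e (x ^ (p ^ l)) = e x}"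

lemma order_divisor_le:
  assumes "g dvd negacyclic_modulus n"
  shows "Polynomial.order x (map_poly to_ac (g :: 'a poly)) \<le> (if x \<in> roots then p ^ r else 0)"
  unfolding order_modulus[symmetric] using assms n_pos
  by (intro dvd_imp_order_le) (simp_all add: negacyclic_modulus_nonzero map_poly_to_ac_dvd_iff)

text \<open>All roots of \<open>g\<close> in the closure lie in \<open>roots\<close>, so orders need
  comparing only there.\<close>

lemma dvd_iff_exponents_le:
  assumes "g dvd negacyclic_modulus n" "f \<noteq> 0"
  shows "g dvd f \<longleftrightarrow> (\<forall>x\<in>roots. exponents g x \<le> Polynomial.order x (map_poly to_ac f))"
proof -
  have "g \<noteq> 0"
    using assms(1) negacyclic_modulus_nonzero[OF n_pos, where ?'a = 'a] by auto
  then have "g dvd f \<longleftrightarrow>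
      (\<forall>x. Polynomial.order x (map_poly to_ac g) \<le> Polynomial.order x (map_poly to_ac f))"
    using assms(2) dvd_iff_order_le[of "map_poly to_ac g" "map_poly to_ac f"]
    by (simp add: map_poly_to_ac_dvd_iff)
  also have "\<dots> \<longleftrightarrow> (\<forall>x\<in>roots. exponents g x \<le> Polynomial.order x (map_poly to_ac f))"
    using order_divisor_le[OF assms(1)] by (auto simp: exponents_def split: if_splits) (metis le_0_eq zero_le)
  finally show ?thesis .
qed

lemma exponents_inject:
  assumes "g \<in> divisors" "h \<in> divisors" "exponents g = exponents h"
  shows "g = h"
proof -
  have nz: "g \<noteq> 0" "h \<noteq> 0" using assms by (auto simp: divisors_def)
  have "Polynomial.order x (map_poly to_ac g) = Polynomial.order x (map_poly to_ac h)"
    if "x \<in> roots" for x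
    using fun_cong[OF assms(3), of x] that by (simp add: exponents_def)
  then have "g dvd h" "h dvd g"
    using assms nz by (simp_all add: dvd_iff_exponents_le divisors_def exponents_def)
  then show ?thesis
    using assms by (intro monic_dvd_antisym) (auto simp: divisors_def)
qed

text \<open>The coefficients of \<open>g\<close> are fixed by the \<open>q\<close>-power map, so
  this map sends \<open>g\<close> to itself while moving the root \<open>x\<close> to
  \<open>x^q\<close> with the same multiplicity.\<close>

lemma exponents_in_exponent_functions:
  assumes "g \<in> divisors"
  shows "exponents g \<in> exponent_functions"
proof -
  have g: "g dvd negacyclic_modulus n" "g \<noteq> 0" using assms by (auto simp: divisors_def)
  have "exponents g (x ^ (p ^ l)) = exponents g x" if "x \<in> roots" for x
  proof -
    have "map_poly (\<lambda>x. x ^ (p ^ l)) (map_poly to_ac g) = map_poly to_ac g"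
      using prime_p frobenius_fixed_iff[of "to_ac _"]
      by (intro poly_eqI) (simp add: coeff_map_poly power_0_left prime_gt_0_nat flip: to_ac_power)
    moreover have "Polynomial.order (x ^ (p ^ l)) (map_poly (\<lambda>x. x ^ (p ^ l)) (map_poly to_ac g)) =
        Polynomial.order x (map_poly to_ac g)"
      using g prime_p by (intro order_map_poly_hom)
        (auto simp: frobenius_add power_mult_distrib power_0_left)
    ultimately show ?thesis
      using that frobenius_in_roots by (simp add: exponents_def)
  qed
  moreover have "exponents g \<in> roots \<rightarrow>\<^sub>E {0..p ^ r}"
    using order_divisor_le[OF g(1)] by (fastforce simp: exponents_def split: if_splits)
  ultimately show ?thesis by (simp add: exponent_functions_def)
qed

text \<open>Take the product of the linear factors at the roots with multiplicities
  \<open>e x\<close>. Frobenius merely permutes these factors, so the coefficients are fixed and lie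
  in the base field.\<close>

lemma exponent_functions_realized:
  assumes e: "e \<in> exponent_functions"
  shows "\<exists>g\<in>divisors. exponents g = e"
proof -
  define q where "q = p ^ l"
  define G where "G = (\<Prod>x\<in>roots. [:-x, 1:] ^ e x)"
  have Gnz: "G \<noteq> 0" using finite_roots by (simp add: G_def prod_zero_iff)
  have q: "q > 0" "odd q" using prime_p odd_p by (simp_all add: q_def prime_gt_0_nat)
  have "map_poly (\<lambda>x. x ^ q) G = (\<Prod>x\<in>roots. map_poly (\<lambda>x. x ^ q) ([:-x, 1:] ^ e x))"
    unfolding G_def using q by (intro map_poly_hom_prod)
      (auto simp: q_def frobenius_add power_mult_distrib)
  also have "\<dots> = (\<Prod>x\<in>roots. [:- (x ^ q), 1:] ^ e x)"
  proof (rule prod.cong[OF refl])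
    fix x assume "x \<in> roots"
    have "map_poly (\<lambda>x. x ^ q) ([:-x, 1:] ^ e x) = map_poly (\<lambda>x. x ^ q) [:-x, 1:] ^ e x"
      using q by (intro map_poly_hom_power) (auto simp: q_def frobenius_add power_mult_distrib)
    then show "map_poly (\<lambda>x. x ^ q) ([:-x, 1:] ^ e x) = [:- (x ^ q), 1:] ^ e x"
      using q by (simp add: map_poly_pCons)
  qed
  \<comment> \<open>Invariance of \<open>e\<close> lets the exponent follow the moved root, so that
    the product can be reindexed along the Frobenius permutation.\<close>
  also have "\<dots> = (\<Prod>x\<in>roots. [:- (x ^ q), 1:] ^ e (x ^ q))"
    using e by (intro prod.cong) (auto simp: exponent_functions_def q_def)
  also have "\<dots> = G"
    unfolding G_def q_def by (rule prod.reindex_bij_betw[OF bij_frobenius_roots])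
  finally have fix_G: "map_poly (\<lambda>x. x ^ q) G = G" .
  have "poly.coeff G i \<in> range to_ac" for i
    using arg_cong[OF fix_G, of "\<lambda>A. poly.coeff A i"] q
    by (simp add: coeff_map_poly frobenius_fixed_iff[symmetric] q_def)
  then have G: "map_poly to_ac (map_poly of_ac G) = G"
    by (intro poly_eqI) (simp add: coeff_map_poly to_ac_of_ac)
  define g where "g = map_poly of_ac G"
  have order_G: "Polynomial.order x G = (if x \<in> roots then e x else 0)" for x
    unfolding G_def by (rule order_prod_linear[OF finite_roots])
  have exps: "exponents g = e"
    using e by (auto simp: exponents_def g_def G order_G exponent_functions_def fun_eq_iff
        restrict_def PiE_def extensional_def)
  have "lead_coeff G = 1"
    by (simp add: G_def lead_coeff_prod lead_coeff_power)
  then have "to_ac (lead_coeff g) = 1"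
    using G degree_map_poly_to_ac[of g] coeff_map_poly[of to_ac g "degree g"] by (simp add: g_def)
  then have "lead_coeff g = 1"
    by (metis to_ac_1 to_ac_eq_iff)
  moreover have "g dvd negacyclic_modulus n"
  proof -
    have "G dvd map_poly to_ac (negacyclic_modulus n)"
      using e n_pos Gnz by (subst dvd_iff_order_le)
        (auto simp: order_G order_modulus negacyclic_modulus_nonzero exponent_functions_def PiE_def Pi_def)
    then show ?thesis by (metis G g_def map_poly_to_ac_dvd_iff)
  qed
  ultimately show ?thesis using exps by (auto simp: divisors_def)
qed

text \<open>A word is orthogonal to the code of \<open>g\<close> iff its reversal is divisible by
  the cofactor \<open>h\<close> of \<open>g\<close>. The multiplicities of \<open>h\<close> are
  those of \<open>g\<close> subtracted from \<open>p ^ r\<close>, and reversal replaces each root by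
  its inverse.\<close>

lemma euclid_dual_poly_code:
  assumes g: "g \<in> divisors" and k: "k \<in> divisors"
    and exps: "\<And>x. x \<in> roots \<Longrightarrow> exponents k x = p ^ r - exponents g (1 / x)"
  shows "euclid_dual n (poly_code n g) = poly_code n k"
proof -
  define M :: "'a poly" where "M = negacyclic_modulus n"
  have M: "M \<noteq> 0" using n_pos by (simp add: M_def negacyclic_modulus_nonzero)
  have "g dvd M" using g by (simp add: divisors_def M_def)
  then obtain h where gh: "g * h = M" by (metis dvdE)
  then have h: "h dvd negacyclic_modulus n" by (metis M_def dvd_triv_right)
  have nz: "g \<noteq> 0" "h \<noteq> 0" using gh M by auto
  have exps_h: "exponents h x = p ^ r - exponents g x" if "x \<in> roots" for x
  proof -
    have "Polynomial.order x (map_poly to_ac M) =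
        Polynomial.order x (map_poly to_ac g) + Polynomial.order x (map_poly to_ac h)"
      unfolding gh[symmetric] map_poly_to_ac_mult using nz by (intro order_mult) simp
    then show ?thesis using that by (simp add: M_def order_modulus exponents_def)
  qed
  have "h dvd rev_poly n f \<longleftrightarrow> k dvd f" if "degree f < n" for f
  proof (cases "f = 0")
    case False
    have "h dvd rev_poly n f \<longleftrightarrow>
        (\<forall>x\<in>roots. p ^ r - exponents g x \<le> Polynomial.order (1 / x) (map_poly to_ac f))"
      using h False by (simp add: dvd_iff_exponents_le order_map_poly_rev_poly roots_nonzero exps_h)
    also have "\<dots> \<longleftrightarrow>
        (\<forall>x\<in>roots. p ^ r - exponents g (1 / x) \<le> Polynomial.order x (map_poly to_ac f))"
      by (rule ball_inverse_roots)
    also have "\<dots> \<longleftrightarrow> k dvd f"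
      using k False by (simp add: dvd_iff_exponents_le exps divisors_def)
    finally show ?thesis .
  qed (simp add: rev_poly_def)
  then have *: "poly.coeff f \<in> euclid_dual n (poly_code n g) \<longleftrightarrow> poly.coeff f \<in> poly_code n k"
    if "degree f < n" for f
    using that mem_euclid_dual_poly_code_iff[OF n_pos gh[unfolded M_def] that]
    by (simp add: coeff_in_poly_code_iff)
  have "euclid_dual n (poly_code n g) \<subseteq> vecs n" "poly_code n k \<subseteq> vecs n"
    using linear_code_poly_code[OF n_pos, of k] by (auto simp: euclid_dual_def linear_code_def)
  moreover have "v \<in> euclid_dual n (poly_code n g) \<longleftrightarrow> v \<in> poly_code n k" if v: "v \<in> vecs n" for v
  proof -
    obtain f where "v = poly.coeff f" "degree f < n"
      using vecs_obtain_poly[OF v n_pos] by blast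
    then show ?thesis using * by simp
  qed
  ultimately show ?thesis by blast
qed

text \<open>Self-dual negacyclic codes and antisymmetric exponent functions are two injective images
  of one set \<open>D\<close> of divisors.\<close>

lemma NE_eq_card_exponent_functions:
  "NE TYPE('a) n = card {e \<in> exponent_functions. \<forall>x\<in>roots. e (1 / x) = p ^ r - e x}"
proof -
  have self_dual: "euclid_self_dual n (poly_code n g) \<longleftrightarrow>
      (\<forall>x\<in>roots. exponents g (1 / x) = p ^ r - exponents g x)" if g: "g \<in> divisors" for g
  proof -
    \<comment> \<open>This is the exponent function that the generator of the dual code must have;
      it is again Frobenius-invariant, hence realized by some divisor \<open>k\<close>.\<close>
    define e where "e = (\<lambda>x\<in>roots. p ^ r - exponents g (1 / x))"
    have "exponents g \<in> exponent_functions"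
      using g by (rule exponents_in_exponent_functions)
    then have "e \<in> exponent_functions"
      by (auto simp: exponent_functions_def e_def frobenius_in_roots inverse_in_roots
          simp flip: power_one_over)
    then obtain k where k: "k \<in> divisors" "exponents k = e"
      using exponent_functions_realized by blast
    have "euclid_dual n (poly_code n g) = poly_code n k"
      using g k by (intro euclid_dual_poly_code) (auto simp: e_def)
    then have "euclid_self_dual n (poly_code n g) \<longleftrightarrow> g = k"
      using g k poly_code_inject[OF n_pos, of g k] by (auto simp: euclid_self_dual_def divisors_def)
    also have "\<dots> \<longleftrightarrow> exponents g = e"
      using exponents_inject g k by auto
    also have "\<dots> \<longleftrightarrow> (\<forall>x\<in>roots. exponents g x = p ^ r - exponents g (1 / x))"
      by (auto simp: e_def fun_eq_iff restrict_def exponents_def)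
    also have "\<dots> \<longleftrightarrow> (\<forall>x\<in>roots. exponents g (1 / x) = p ^ r - exponents g x)"
      by (rule ball_inverse_roots)
    finally show ?thesis .
  qed
  define D where "D = {g \<in> divisors. \<forall>x\<in>roots. exponents g (1 / x) = p ^ r - exponents g x}"
  have "{C :: (nat \<Rightarrow> 'a) set. linear_code n C \<and> negacyclic n C \<and> euclid_self_dual n C} = poly_code n ` D"
  proof (intro equalityI subsetI)
    fix C :: "(nat \<Rightarrow> 'a) set"
    assume "C \<in> {C. linear_code n C \<and> negacyclic n C \<and> euclid_self_dual n C}"
    then have C: "linear_code n C" "negacyclic n C" "euclid_self_dual n C" by auto
    then obtain g where "lead_coeff g = 1" "g dvd negacyclic_modulus n" "C = poly_code n g"
      using negacyclic_code_is_poly_code n_pos by blast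
    then show "C \<in> poly_code n ` D"
      using C self_dual by (auto simp: D_def divisors_def)
  next
    fix C assume "C \<in> poly_code n ` D"
    then show "C \<in> {C. linear_code n C \<and> negacyclic n C \<and> euclid_self_dual n C}"
      using self_dual n_pos by (auto simp: D_def divisors_def linear_code_poly_code negacyclic_poly_code)
  qed
  moreover have "inj_on (poly_code n) D"
    using poly_code_inject n_pos by (auto simp: inj_on_def D_def divisors_def)
  moreover have "{e \<in> exponent_functions. \<forall>x\<in>roots. e (1 / x) = p ^ r - e x} = exponents ` D"
    using exponent_functions_realized exponents_in_exponent_functions by (fastforce simp: D_def)
  moreover have "inj_on exponents D"
    using exponents_inject by (auto simp: inj_on_def D_def)
  ultimately show ?thesis
    by (simp add: NE_def card_image)
qed

end

subsection \<open>Counting Frobenius orbits\<close>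

text \<open>The fixed-point-free involution splits \<open>S\<close> into pairs; the value at one
  member of a pair is free, with \<open>N + 1\<close> choices, and determines the other.\<close>

lemma card_antisymmetric_functions:
  fixes N :: nat
  assumes fin: "finite S" and inv: "\<And>s. s \<in> S \<Longrightarrow> i s \<in> S" "\<And>s. s \<in> S \<Longrightarrow> i (i s) = s"
    and no_fix: "\<And>s. s \<in> S \<Longrightarrow> i s \<noteq> s"
  obtains k where "card S = 2 * k"
    "card {f \<in> S \<rightarrow>\<^sub>E {0..N}. \<forall>s\<in>S. f (i s) = N - f s} = (N + 1) ^ k"
proof -
  obtain h :: "'a \<Rightarrow> nat" where h: "inj_on h S"
    using finite_imp_inj_to_nat_seg[OF fin] by blast
  \<comment> \<open>An injection into the naturals breaks the symmetry: \<open>T\<close> contains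
    the smaller-numbered member of each pair.\<close>
  define T where "T = {s \<in> S. h s < h (i s)}"
  have TS: "T \<subseteq> S" and finT: "finite T" using fin by (auto simp: T_def)
  have T_iff: "i s \<in> T \<longleftrightarrow> s \<notin> T" if "s \<in> S" for s
  proof -
    have "h s \<noteq> h (i s)"
      using inj_onD[OF h _ that inv(1)[OF that]] no_fix[OF that] by metis
    then show ?thesis
      using inv(1)[OF that] inv(2)[OF that] that by (auto simp: T_def)
  qed
  have "i ` T = S - T"
  proof (intro equalityI subsetI)
    fix s assume "s \<in> i ` T"
    then obtain t where "t \<in> T" "s = i t" by blast
    then show "s \<in> S - T" using T_iff[of t] inv(1)[of t] TS by blast
  next
    fix s assume "s \<in> S - T"
    then have "i s \<in> T" "i (i s) = s" using T_iff[of s] inv(2)[of s] by blast+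
    then show "s \<in> i ` T" by (metis imageI)
  qed
  moreover have "inj_on i T" using TS inv(2) by (intro inj_on_inverseI[of _ i]) blast
  ultimately have "card (S - T) = card T" using card_image[of i T] by simp
  then have card_S: "card S = 2 * card T"
    using card_Diff_subset[OF finT TS] card_mono[OF fin TS] by linarith
  let ?F = "{f \<in> S \<rightarrow>\<^sub>E {0..N}. \<forall>s\<in>S. f (i s) = N - f s}"
  have "bij_betw (\<lambda>f. restrict f T) ?F (T \<rightarrow>\<^sub>E {0..N})"
  proof (rule bij_betw_byWitness[where f' = "\<lambda>g. \<lambda>s\<in>S. if s \<in> T then g s else N - g (i s)"])
    show "\<forall>f\<in>?F. (\<lambda>s\<in>S. if s \<in> T then restrict f T s else N - restrict f T (i s)) = f"
    proof
      fix f assume f: "f \<in> ?F"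
      show "(\<lambda>s\<in>S. if s \<in> T then restrict f T s else N - restrict f T (i s)) = f"
      proof
        fix s
        show "(\<lambda>s\<in>S. if s \<in> T then restrict f T s else N - restrict f T (i s)) s = f s"
        proof (cases "s \<in> S")
          case True
          \<comment> \<open>The bound makes truncated subtraction an involution on the values:
            \<open>N - (N - f s) = f s\<close>.\<close>
          then have "f s \<le> N" "f (i s) = N - f s" using f by (auto simp: PiE_iff)
          then show ?thesis using True T_iff[OF True] by auto
        qed (use f in \<open>auto simp: PiE_def extensional_def\<close>)
      qed
    qed
    show "\<forall>g\<in>T \<rightarrow>\<^sub>E {0..N}. restrict (\<lambda>s\<in>S. if s \<in> T then g s else N - g (i s)) T = g"
      using TS by (auto simp: fun_eq_iff restrict_def PiE_def extensional_def)
    show "(\<lambda>f. restrict f T) ` ?F \<subseteq> T \<rightarrow>\<^sub>E {0..N}"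
      using TS by (auto simp: PiE_iff)
    show "(\<lambda>g. \<lambda>s\<in>S. if s \<in> T then g s else N - g (i s)) ` (T \<rightarrow>\<^sub>E {0..N}) \<subseteq> ?F"
    proof (rule image_subsetI)
      fix g assume g: "g \<in> T \<rightarrow>\<^sub>E {0..N}"
      let ?f = "\<lambda>s\<in>S. if s \<in> T then g s else N - g (i s)"
      have "?f (i s) = N - ?f s" if s: "s \<in> S" for s
      proof (cases "s \<in> T")
        case True
        then show ?thesis using s inv(1)[OF s] inv(2)[OF s] T_iff[OF s] by simp
      next
        case False
        then have "g (i s) \<le> N" using g T_iff[OF s] by (auto simp: PiE_iff)
        then show ?thesis using False s inv(1)[OF s] T_iff[OF s] by simp
      qed
      moreover have "?f \<in> S \<rightarrow>\<^sub>E {0..N}"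
      proof (rule PiE_I)
        fix s assume s: "s \<in> S"
        then have "s \<in> T \<or> i s \<in> T" using T_iff[OF s] by blast
        then show "?f s \<in> {0..N}" using g s by (auto simp: PiE_iff)
      qed simp
      ultimately show "?f \<in> ?F" by blast
    qed
  qed
  then have "card ?F = card (T \<rightarrow>\<^sub>E {0..N})"
    by (rule bij_betw_same_card)
  then have "card ?F = (N + 1) ^ card T"
    using card_funcsetE[OF finT, of "{0..N}"] by simp
  with card_S show ?thesis by (rule that)
qed

text \<open>Divisibility form of the order, convenient for comparing powers; \<open>N = 0\<close>
  encodes infinite order.\<close>

definition has_mult_order :: "'a::monoid_mult \<Rightarrow> nat \<Rightarrow> bool" where
  "has_mult_order x N \<longleftrightarrow> (\<forall>k. x ^ k = 1 \<longleftrightarrow> N dvd k)"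

lemma power_eq_1_iff_dvd: "has_mult_order x N \<Longrightarrow> x ^ k = 1 \<longleftrightarrow> N dvd k"
  by (simp only: has_mult_order_def)

lemma has_mult_order_unique:
  assumes "has_mult_order x N" "has_mult_order x N'"
  shows "N = N'"
proof -
  have "N dvd k \<longleftrightarrow> N' dvd k" for k
    using assms by (simp add: has_mult_order_def)
  from this[of N] this[of N'] show ?thesis by (simp add: dvd_antisym)
qed

lemma has_mult_order_exists:
  fixes x :: "'a::monoid_mult"
  assumes "x ^ N = 1" "N > 0"
  obtains d where "has_mult_order x d" "d dvd N"
proof -
  define d where "d = (LEAST d. d > 0 \<and> x ^ d = 1)"
  have d: "d > 0" "x ^ d = 1"
    using LeastI[of "\<lambda>d. d > 0 \<and> x ^ d = 1" N] assms by (auto simp: d_def)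
  have "x ^ k = 1 \<longleftrightarrow> d dvd k" for k
  proof
    assume "x ^ k = 1"
    have "x ^ k = x ^ (d * (k div d) + k mod d)" by simp
    also have "\<dots> = x ^ (k mod d)" using d by (simp only: power_add power_mult) simp
    finally have "x ^ (k mod d) = 1" using \<open>x ^ k = 1\<close> by simp
    moreover have "k mod d < d" using d by simp
    ultimately have "k mod d = 0" using not_less_Least[of "k mod d" "\<lambda>d. d > 0 \<and> x ^ d = 1"]
      by (auto simp: d_def)
    then show "d dvd k" by auto
  qed (use d in \<open>auto simp: power_mult\<close>)
  then have "has_mult_order x d" by (simp add: has_mult_order_def)
  moreover from this have "d dvd N" using assms by (simp add: has_mult_order_def)
  ultimately show ?thesis by (rule that)
qed

lemma power_eq_power_iff_cong:
  fixes x :: "'a::field"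
  assumes "has_mult_order x N" "N > 0"
  shows "x ^ a = x ^ b \<longleftrightarrow> [a = b] (mod N)"
proof -
  have "x ^ N = 1" using assms by (simp add: has_mult_order_def)
  then have "x \<noteq> 0" using assms by (auto simp: power_0_left)
  have *: "x ^ a = x ^ b \<longleftrightarrow> [a = b] (mod N)" if "a \<le> b" for a b
  proof -
    have "x ^ b = x ^ a * x ^ (b - a)" using that by (simp flip: power_add)
    then have "x ^ a = x ^ b \<longleftrightarrow> x ^ (b - a) = 1" using \<open>x \<noteq> 0\<close> by auto
    also have "\<dots> \<longleftrightarrow> [b = a] (mod N)"
      using assms that by (simp add: has_mult_order_def cong_altdef_nat)
    finally show ?thesis by (simp add: cong_sym_eq)
  qed
  show ?thesis
  proof (cases "a \<le> b")
    case False
    then have "x ^ b = x ^ a \<longleftrightarrow> [b = a] (mod N)" by (intro *) simp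
    then show ?thesis unfolding cong_sym_eq[of b a] by (simp add: eq_commute)
  qed (rule *)
qed

lemma has_mult_order_power:
  fixes x :: "'a::monoid_mult"
  assumes "has_mult_order x N" "coprime N a"
  shows "has_mult_order (x ^ a) N"
proof -
  have "(x ^ a) ^ k = 1 \<longleftrightarrow> N dvd k" for k
    using assms coprime_dvd_mult_right_iff[OF assms(2), of k]
    unfolding has_mult_order_def power_mult[symmetric] by blast
  then show ?thesis by (simp only: has_mult_order_def simp_thms)
qed

text \<open>An even \<open>k\<close> would make \<open>q^k + 1\<close> congruent to 2 modulo 4, so
  \<open>k\<close> is odd. Then \<open>q^k + 1\<close> is \<open>q + 1\<close> times an odd number,
  and the whole power of two sits in \<open>q + 1\<close>.\<close>

lemma two_power_dvd_power_plus_1: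
  fixes q :: nat
  assumes dvd: "2 ^ (\<nu> + 1) dvd q ^ k + 1" and "\<nu> > 0" "odd q"
  shows "2 ^ (\<nu> + 1) dvd q + 1"
proof -
  have "4 dvd (2 :: nat) ^ (\<nu> + 1)"
    using le_imp_power_dvd[of 2 "\<nu> + 1" "2 :: nat"] assms by simp
  then have four: "4 dvd q ^ k + 1" using dvd by (rule dvd_trans)
  have "odd k"
  proof
    assume "even k"
    then obtain j where "k = 2 * j" by auto
    then have "q ^ k = (q ^ j)\<^sup>2" by (simp add: power_mult[symmetric] mult.commute)
    moreover obtain t where "q ^ j = 2 * t + 1" using assms by (metis oddE even_power)
    ultimately have "q ^ k + 1 = 4 * (t * t + t) + 2" by (simp add: power2_eq_square algebra_simps)
    with four have "4 dvd (2 :: nat)"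
      by (metis dvd_add_right_iff dvd_triv_left)
    then show False by simp
  qed
  then obtain j where k: "k = 2 * j + 1" by (metis oddE)
  \<comment> \<open>The cofactor is the alternating sum of the powers of \<open>q\<close> up to
    \<open>2 * j\<close>, taken in the integers to allow signs. The recursion subtracts the even
    number \<open>q - 1\<close> from an odd one, so oddness persists.\<close>
  have "\<exists>s :: int. odd s \<and> int q ^ (2 * j + 1) + 1 = (int q + 1) * s"
  proof (induction j)
    case 0
    show ?case by (intro exI[of _ 1]) simp
  next
    case (Suc j)
    then obtain s where s: "odd s" "int q ^ (2 * j + 1) + 1 = (int q + 1) * s" by blast
    have "int q ^ (2 * Suc j + 1) + 1 = (int q)\<^sup>2 * (int q ^ (2 * j + 1) + 1) - ((int q)\<^sup>2 - 1)"
      by (simp add: algebra_simps power2_eq_square)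
    also have "\<dots> = (int q + 1) * ((int q)\<^sup>2 * s - (int q - 1))"
      unfolding s(2) by (simp add: algebra_simps power2_eq_square)
    finally show ?case using s(1) assms(3) by (intro exI[of _ "(int q)\<^sup>2 * s - (int q - 1)"]) auto
  qed
  then obtain s :: int where "odd s" "int q ^ k + 1 = (int q + 1) * s"
    unfolding k by blast
  then have s: "odd s" "int (q ^ k + 1) = int (q + 1) * s"
    by (blast, simp only: of_nat_add of_nat_power of_nat_1)
  have "int (2 ^ (\<nu> + 1)) dvd int (q + 1) * s"
    using dvd by (metis s(2) int_dvd_int_iff)
  moreover have "coprime (int (2 ^ (\<nu> + 1))) s" using s(1) by simp
  ultimately have "int (2 ^ (\<nu> + 1)) dvd int (q + 1)"
    by (simp only: coprime_dvd_mult_left_iff)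
  then show ?thesis by (simp only: int_dvd_int_iff)
qed

section \<open>Elements of given multiplicative order and Frobenius orbits in the closure\<close>

context negacyclic_length
begin

text \<open>The derivative of \<open>X^N - 1\<close> vanishes at most at 0 because \<open>p\<close>
  does not divide \<open>N\<close>, so all roots are simple.\<close>

lemma card_roots_of_unity:
  assumes "N > 0" "\<not> p dvd N"
  shows "card {x :: 'a alg_closure. x ^ N = 1} = N"
    and "finite {x :: 'a alg_closure. x ^ N = 1}"
proof -
  define A :: "'a alg_closure poly" where "A = monom 1 N + (- 1)"
  have deg: "degree A = N"
    unfolding A_def using assms by (subst degree_add_eq_left) (simp_all add: degree_monom_eq)
  then have A: "A \<noteq> 0" using assms by auto
  have eq: "{x. x ^ N = 1} = {x. poly A x = 0}" by (simp add: A_def poly_monom)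
  have "poly (pderiv A) x \<noteq> 0" if "poly A x = 0" for x
  proof -
    have "x \<noteq> 0" using that assms by (auto simp: A_def poly_monom power_0_left)
    then show ?thesis
      using assms by (simp add: A_def pderiv_diff pderiv_monom poly_monom of_nat_eq_0_iff)
  qed
  then show "card {x :: 'a alg_closure. x ^ N = 1} = N" "finite {x :: 'a alg_closure. x ^ N = 1}"
    using card_simple_roots[OF A] poly_roots_finite[OF A] deg eq by simp_all
qed

lemma finite_has_mult_order:
  assumes "N > 0" "\<not> p dvd N"
  shows "finite {x :: 'a alg_closure. has_mult_order x N}"
  by (rule finite_subset[OF _ card_roots_of_unity(2)[OF assms]]) (simp add: power_eq_1_iff_dvd subset_iff)

text \<open>Sorting the \<open>N\<close> roots of unity by their order writes \<open>N\<close> as a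
  sum over its divisors. The totient satisfies the same identity, and by induction all terms below
  \<open>N\<close> agree.\<close>

lemma card_has_mult_order:
  assumes "N > 0" "\<not> p dvd N"
  shows "card {x :: 'a alg_closure. has_mult_order x N} = totient N"
  using assms
proof (induction N rule: less_induct)
  case (less N)
  let ?a = "\<lambda>N. card {x :: 'a alg_closure. has_mult_order x N}"
  have finD: "finite {d. d dvd N}" using less.prems by simp
  have D: "d > 0" "\<not> p dvd d" if "d dvd N" for d
    using that less.prems dvd_trans[of p d N] by (auto simp: dvd_pos_nat)
  have "{x :: 'a alg_closure. x ^ N = 1} = (\<Union>d\<in>{d. d dvd N}. {x. has_mult_order x d})"
  proof (intro equalityI subsetI)
    fix x :: "'a alg_closure" assume "x \<in> {x. x ^ N = 1}"
    then obtain d where "has_mult_order x d" "d dvd N"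
      using less.prems has_mult_order_exists[of x N] by auto
    then show "x \<in> (\<Union>d\<in>{d. d dvd N}. {x. has_mult_order x d})" by auto
  qed (auto simp: power_eq_1_iff_dvd)
  then have "N = card (\<Union>d\<in>{d. d dvd N}. {x :: 'a alg_closure. has_mult_order x d})"
    using card_roots_of_unity(1)[OF less.prems] by simp
  also have "\<dots> = (\<Sum>d | d dvd N. ?a d)"
  proof (rule card_UN_disjoint[OF finD]; intro ballI impI)
    fix d d' assume "d \<in> {d. d dvd N}" "d' \<in> {d. d dvd N}" "d \<noteq> d'"
    then show "{x :: 'a alg_closure. has_mult_order x d} \<inter> {x. has_mult_order x d'} = {}"
      using has_mult_order_unique[of _ d d'] by blast
  qed (use D finite_has_mult_order in blast)
  also have "\<dots> = ?a N + (\<Sum>d\<in>{d. d dvd N} - {N}. ?a d)"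
    using finD by (intro sum.remove) auto
  also have "(\<Sum>d\<in>{d. d dvd N} - {N}. ?a d) = (\<Sum>d\<in>{d. d dvd N} - {N}. totient d)"
  proof (rule sum.cong[OF refl])
    fix d assume d: "d \<in> {d. d dvd N} - {N}"
    then have "d < N" using dvd_imp_le[of d N] less.prems(1) by simp
    then show "?a d = totient d" using d D[of d] by (intro less.IH) simp_all
  qed
  finally have "N = ?a N + (\<Sum>d\<in>{d. d dvd N} - {N}. totient d)" .
  moreover have "N = totient N + (\<Sum>d\<in>{d. d dvd N} - {N}. totient d)"
    using sum.remove[OF finD, of N totient] totient_divisor_sum[of N] by simp
  ultimately show ?case by linarith
qed

text \<open>Nonnegative iterates suffice: on elements of finite order prime to \<open>p\<close> the
  \<open>q\<close>-power map is periodic.\<close>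

definition orbit :: "'a alg_closure \<Rightarrow> 'a alg_closure set" where
  "orbit x = range (\<lambda>k. x ^ ((p ^ l) ^ k))"

lemma self_in_orbit: "x \<in> orbit x"
  unfolding orbit_def by (rule range_eqI[of _ _ 0]) simp

lemma coprime_card_field: "\<not> p dvd N \<Longrightarrow> coprime N (p ^ l)"
  using prime_imp_coprime[OF prime_p] by (metis coprime_commute coprime_power_right_iff)

lemma has_mult_order_orbit:
  assumes "has_mult_order x N" "\<not> p dvd N" "y \<in> orbit x"
  shows "has_mult_order y N"
proof -
  obtain k where k: "y = x ^ ((p ^ l) ^ k)" using assms(3) by (auto simp: orbit_def)
  have "coprime N ((p ^ l) ^ k)"
    using coprime_card_field[OF assms(2)] by (metis coprime_power_right_iff)
  then show ?thesis
    unfolding k using assms(1) has_mult_order_power by blast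
qed

text \<open>Two iterates agree iff \<open>q^i\<close> and \<open>q^j\<close> are congruent modulo
  \<open>N\<close>, that is, iff \<open>i\<close> and \<open>j\<close> are congruent modulo the
  order of \<open>q\<close>.\<close>

lemma orbit_eq_image:
  assumes "has_mult_order x N" "N > 0" "\<not> p dvd N"
  shows "orbit x = (\<lambda>k. x ^ ((p ^ l) ^ k)) ` {..<ord N (p ^ l)}"
    and "inj_on (\<lambda>k. x ^ ((p ^ l) ^ k)) {..<ord N (p ^ l)}"
proof -
  define q where "q = p ^ l"
  have cop: "coprime N q"
    using coprime_card_field[OF assms(3)] by (simp add: q_def)
  have eq: "x ^ (q ^ i) = x ^ (q ^ j) \<longleftrightarrow> [i = j] (mod ord N q)" for i j
    using power_eq_power_iff_cong[OF assms(1,2)] order_divides_expdiff[OF cop] by simp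
  have "ord N q > 0" using cop by simp
  then have "x ^ (q ^ k) \<in> (\<lambda>k. x ^ (q ^ k)) ` {..<ord N q}" for k
    by (intro image_eqI[of _ _ "k mod ord N q"]) (simp_all add: eq cong_def)
  then show "orbit x = (\<lambda>k. x ^ ((p ^ l) ^ k)) ` {..<ord N (p ^ l)}"
    unfolding orbit_def q_def by blast
  have "inj_on (\<lambda>k. x ^ (q ^ k)) {..<ord N q}"
    by (auto simp: inj_on_def eq cong_def)
  then show "inj_on (\<lambda>k. x ^ ((p ^ l) ^ k)) {..<ord N (p ^ l)}"
    by (simp only: q_def)
qed

lemma card_orbit:
  assumes "has_mult_order x N" "N > 0" "\<not> p dvd N"
  shows "card (orbit x) = ord N (p ^ l)"
  unfolding orbit_eq_image(1)[OF assms] card_image[OF orbit_eq_image(2)[OF assms]] by simp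

text \<open>One inclusion is immediate, and both orbits have the size determined by the common
  order; counting replaces running Frobenius backwards.\<close>

lemma orbit_eqI:
  assumes "has_mult_order x N" "N > 0" "\<not> p dvd N" "y \<in> orbit x"
  shows "orbit y = orbit x"
proof (rule card_subset_eq)
  show "finite (orbit x)" unfolding orbit_eq_image(1)[OF assms(1-3)] by simp
  obtain k where k: "y = x ^ ((p ^ l) ^ k)" using assms(4) by (auto simp: orbit_def)
  show "orbit y \<subseteq> orbit x"
  proof
    fix z assume "z \<in> orbit y"
    then obtain j where "z = y ^ ((p ^ l) ^ j)" by (auto simp: orbit_def)
    then have "z = x ^ ((p ^ l) ^ (k + j))" by (simp only: k power_mult power_add)
    then show "z \<in> orbit x" unfolding orbit_def by blast
  qed
  show "card (orbit y) = card (orbit x)"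
    using card_orbit[OF assms(1-3)] card_orbit[OF has_mult_order_orbit[OF assms(1,3,4)] assms(2,3)]
    by simp
qed

lemma not_dvd_two: "\<not> p dvd 2"
  using prime_p odd_p by (metis dvd_refl primes_dvd_imp_eq two_is_prime_nat)

lemma root_has_mult_order:
  assumes "x \<in> roots"
  obtains N where "has_mult_order x N" "N dvd 2 * m" "N > 0" "\<not> p dvd N"
proof -
  have "x ^ (2 * m) = 1" using assms by (simp add: roots_def power_mult mult.commute[of 2])
  then obtain N where N: "has_mult_order x N" "N dvd 2 * m"
    using m_pos has_mult_order_exists[of x "2 * m"] by auto
  moreover have "\<not> p dvd 2 * m"
    using prime_p not_dvd_two p_m by (simp add: prime_dvd_mult_iff)
  ultimately show ?thesis
    using that[of N] m_pos dvd_trans[of p N "2 * m"] by (auto simp: dvd_pos_nat)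
qed

lemma orbit_eq_iff:
  assumes "x \<in> roots"
  shows "orbit y = orbit x \<longleftrightarrow> y \<in> orbit x"
proof
  assume "y \<in> orbit x"
  then show "orbit y = orbit x"
    using root_has_mult_order[OF assms] orbit_eqI by metis
qed (use self_in_orbit in auto)

lemma orbit_inverse: "orbit (1 / x) = (\<lambda>y. 1 / y) ` orbit x"
  unfolding orbit_def image_image power_one_over by (rule refl)

lemma exponent_function_const_on_orbit:
  assumes "e \<in> exponent_functions" "x \<in> roots" "y \<in> orbit x"
  shows "e y = e x"
proof -
  have "x ^ ((p ^ l) ^ k) \<in> roots \<and> e (x ^ ((p ^ l) ^ k)) = e x" for k
  proof (induction k)
    case (Suc k)
    have "x ^ ((p ^ l) ^ Suc k) = (x ^ ((p ^ l) ^ k)) ^ (p ^ l)"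
      by (simp only: power_Suc2 power_mult)
    then show ?case using assms(1) Suc frobenius_in_roots by (simp add: exponent_functions_def)
  qed (use assms in simp)
  then show ?thesis using assms(3) by (auto simp: orbit_def)
qed

text \<open>Frobenius-invariant functions on \<open>roots\<close> are exactly the pullbacks of
  functions on the set of orbits, and inversion acts on orbits by taking images.\<close>

lemma card_exponent_functions:
  "card {e \<in> exponent_functions. \<forall>x\<in>roots. e (1 / x) = p ^ r - e x} =
   card {f \<in> orbit ` roots \<rightarrow>\<^sub>E {0..p ^ r}. \<forall>s\<in>orbit ` roots. f ((\<lambda>y. 1 / y) ` s) = p ^ r - f s}"
  (is "card ?E = card ?F")
proof (rule sym, rule bij_betw_same_card)
  show "bij_betw (\<lambda>f. \<lambda>x\<in>roots. f (orbit x)) ?F ?E"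
  proof (rule bij_betw_imageI)
    show "inj_on (\<lambda>f. \<lambda>x\<in>roots. f (orbit x)) ?F"
    proof (rule inj_onI)
      fix f g assume fg: "f \<in> ?F" "g \<in> ?F" and eq: "(\<lambda>x\<in>roots. f (orbit x)) = (\<lambda>x\<in>roots. g (orbit x))"
      have "f (orbit x) = g (orbit x)" if "x \<in> roots" for x
        using fun_cong[OF eq, of x] that by simp
      then show "f = g"
        using fg by (intro PiE_ext[of f "orbit ` roots" "\<lambda>_. {0..p ^ r}" g]) auto
    qed
    show "(\<lambda>f. \<lambda>x\<in>roots. f (orbit x)) ` ?F = ?E"
    proof (intro equalityI subsetI)
      fix e assume "e \<in> (\<lambda>f. \<lambda>x\<in>roots. f (orbit x)) ` ?F"
      then obtain f where f: "f \<in> ?F" and e: "e = (\<lambda>x\<in>roots. f (orbit x))" by blast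
      have "orbit (x ^ (p ^ l)) = orbit x" if "x \<in> roots" for x
        unfolding orbit_eq_iff[OF that] unfolding orbit_def by (rule range_eqI[of _ _ 1]) simp
      then show "e \<in> ?E"
        using f by (auto simp: e exponent_functions_def frobenius_in_roots inverse_in_roots orbit_inverse)
    next
      fix e assume e: "e \<in> ?E"
      \<comment> \<open>Any representative will do, as \<open>e\<close> is constant on each
        orbit.\<close>
      define f where "f = (\<lambda>s\<in>orbit ` roots. e (SOME x. x \<in> s))"
      have f: "f (orbit x) = e x" if "x \<in> roots" for x
      proof -
        have "(SOME y. y \<in> orbit x) \<in> orbit x" using self_in_orbit by (rule someI)
        then show ?thesis
          using e that exponent_function_const_on_orbit[of e x] by (simp add: f_def)
      qed
      have "f (orbit x) \<in> {0..p ^ r}" if "x \<in> roots" for x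
        using e f[OF that] that by (auto simp: exponent_functions_def PiE_iff)
      then have "f \<in> orbit ` roots \<rightarrow>\<^sub>E {0..p ^ r}"
        by (intro PiE_I) (auto simp: f_def)
      moreover have "f ((\<lambda>y. 1 / y) ` orbit x) = p ^ r - f (orbit x)" if "x \<in> roots" for x
        using that e f inverse_in_roots by (simp flip: orbit_inverse)
      ultimately have "f \<in> ?F" by auto
      moreover have "e = (\<lambda>x\<in>roots. f (orbit x))"
        using e f by (auto simp: fun_eq_iff restrict_def exponent_functions_def PiE_def extensional_def)
      ultimately show "e \<in> (\<lambda>f. \<lambda>x\<in>roots. f (orbit x)) ` ?F" by blast
    qed
  qed
qed

end

section \<open>Orders and orbits of the roots when m is a power of two times an odd number\<close>

locale negacyclic_even_length = negacyclic_length field_type p l r m n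
  for field_type :: "'a::{field,finite} itself" and p l r m n +
  fixes \<nu> n' :: nat
  assumes m_eq: "m = 2 ^ \<nu> * n'" and odd_n': "odd n'" and \<nu>_pos: "\<nu> > 0"
begin

lemma order_pos: "d dvd n' \<Longrightarrow> d * 2 ^ (\<nu> + 1) > 0"
  using odd_n' by (cases "d = 0") simp_all

lemma order_not_dvd:
  assumes "d dvd n'"
  shows "\<not> p dvd d * 2 ^ (\<nu> + 1)"
proof
  assume "p dvd d * 2 ^ (\<nu> + 1)"
  then have "p dvd d"
    using prime_p not_dvd_two by (metis prime_dvd_mult_iff prime_dvd_power)
  then show False using assms p_m by (simp add: m_eq dvd_mult dvd_trans)
qed

text \<open>The order of a root divides \<open>2 * m\<close> but not \<open>m\<close>, which forces
  the full factor \<open>2 ^ (\<nu> + 1)\<close> and leaves a divisor of \<open>n'\<close>.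
  Conversely such an order makes \<open>x ^ m\<close> a square root of 1 other than 1.\<close>

lemma root_iff_has_mult_order:
  "x \<in> roots \<longleftrightarrow> (\<exists>d. d dvd n' \<and> has_mult_order x (d * 2 ^ (\<nu> + 1)))"
proof
  assume x: "x \<in> roots"
  have "(2 :: 'a alg_closure) \<noteq> 0" using of_nat_eq_0_iff[of 2] not_dvd_two by simp
  then have "(- 1 :: 'a alg_closure) \<noteq> 1"
    by (metis add.right_inverse one_add_one)
  then have xm: "x ^ m \<noteq> 1" using x by (simp add: roots_def)
  obtain N where N: "has_mult_order x N" "N dvd 2 * m"
    using root_has_mult_order[OF x] by blast
  have "N dvd 2 ^ (\<nu> + 1) * n'" using N(2) by (simp add: m_eq mult.assoc)
  then obtain b d where bd: "N = b * d" "b dvd 2 ^ (\<nu> + 1)" "d dvd n'"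
    using division_decomp by blast
  then obtain i where i: "i \<le> \<nu> + 1" "b = 2 ^ i"
    using divides_primepow_nat[OF two_is_prime_nat, of b "\<nu> + 1"] by blast
  have "\<not> i \<le> \<nu>"
  proof
    assume "i \<le> \<nu>"
    then have "b dvd 2 ^ \<nu>" using i by (simp add: le_imp_power_dvd)
    then have "N dvd m" using bd by (simp add: m_eq mult_dvd_mono)
    then show False using N(1) xm by (simp add: has_mult_order_def)
  qed
  then have "i = \<nu> + 1" using i by simp
  then show "\<exists>d. d dvd n' \<and> has_mult_order x (d * 2 ^ (\<nu> + 1))"
    using bd i N by (metis mult.commute)
next
  assume "\<exists>d. d dvd n' \<and> has_mult_order x (d * 2 ^ (\<nu> + 1))"
  then obtain d where d: "d dvd n'" "has_mult_order x (d * 2 ^ (\<nu> + 1))" by blast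
  have "d * 2 ^ (\<nu> + 1) dvd n' * 2 ^ (\<nu> + 1)"
    using d(1) by (intro mult_dvd_mono) simp_all
  then have "d * 2 ^ (\<nu> + 1) dvd m * 2" by (simp add: m_eq mult_ac)
  then have "x ^ (m * 2) = 1" using d(2) unfolding has_mult_order_def by blast
  then have "x ^ m = 1 \<or> x ^ m = - 1" by (simp add: power_mult power2_eq_1_iff)
  moreover have "x ^ m \<noteq> 1"
  proof
    assume "x ^ m = 1"
    then have "2 ^ \<nu> * 2 dvd 2 ^ \<nu> * n'"
      using d(2) unfolding has_mult_order_def m_eq by (metis dvd_mult_right power_add power_one_right)
    then show False using odd_n' by simp
  qed
  ultimately show "x \<in> roots" by (simp add: roots_def)
qed

text \<open>Each admissible order contributes its totient many roots, split into orbits whose common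
  size is the order of \<open>q\<close> modulo it. Different \<open>d\<close> give different orbits
  because the multiplicative order is constant along an orbit.\<close>

lemma card_orbits:
  "real (card (orbit ` roots)) =
   (\<Sum>d | d dvd n'. real (totient (d * 2 ^ (\<nu> + 1))) / real (ord (d * 2 ^ (\<nu> + 1)) (p ^ l)))"
proof -
  define U where "U = (\<lambda>d. {x :: 'a alg_closure. has_mult_order x (d * 2 ^ (\<nu> + 1))})"
  have roots: "roots = (\<Union>d\<in>{d. d dvd n'}. U d)"
    using root_iff_has_mult_order by (auto simp: U_def)
  have fin: "finite {d. d dvd n'}" using odd_n' by (intro finite_divisors_nat) (auto intro: Nat.gr0I)
  have finX: "finite (U d)" if "d dvd n'" for d
    unfolding U_def using that by (intro finite_has_mult_order order_pos order_not_dvd)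
  have "card (orbit ` roots) = card (\<Union>d\<in>{d. d dvd n'}. orbit ` U d)"
    unfolding roots image_UN by (rule refl)
  also have "\<dots> = (\<Sum>d | d dvd n'. card (orbit ` U d))"
  proof (intro card_UN_disjoint fin ballI impI)
    fix d d' assume d: "d \<in> {d. d dvd n'}" "d' \<in> {d. d dvd n'}" "d \<noteq> d'"
    show "orbit ` U d \<inter> orbit ` U d' = {}"
    proof (rule ccontr)
      assume "orbit ` U d \<inter> orbit ` U d' \<noteq> {}"
      then obtain x y where xy: "x \<in> U d" "y \<in> U d'" "orbit x = orbit y" by auto
      have "x \<in> orbit y" using xy(3) self_in_orbit[of x] by simp
      moreover have "has_mult_order y (d' * 2 ^ (\<nu> + 1))" using xy(2) by (simp only: U_def mem_Collect_eq)
      moreover have "\<not> p dvd d' * 2 ^ (\<nu> + 1)" using d by (intro order_not_dvd) simp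
      ultimately have "has_mult_order x (d' * 2 ^ (\<nu> + 1))"
        using has_mult_order_orbit by blast
      then have "d * 2 ^ (\<nu> + 1) = d' * 2 ^ (\<nu> + 1)"
        using xy(1) has_mult_order_unique unfolding U_def by blast
      then show False using d by simp
    qed
  qed (use finX in auto)
  finally have "real (card (orbit ` roots)) = (\<Sum>d | d dvd n'. real (card (orbit ` U d)))" by simp
  also have "\<dots> = (\<Sum>d | d dvd n'. real (totient (d * 2 ^ (\<nu> + 1))) / real (ord (d * 2 ^ (\<nu> + 1)) (p ^ l)))"
  proof (rule sum.cong[OF refl])
    fix d assume "d \<in> {d. d dvd n'}"
    then have d: "d dvd n'" by simp
    define N where "N = d * 2 ^ (\<nu> + 1)"
    have N: "N > 0" "\<not> p dvd N" unfolding N_def using d order_pos order_not_dvd by blast+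
    have U: "U d = {x. has_mult_order x N}" by (simp only: U_def N_def)
    have un: "\<Union> (orbit ` U d) = U d"
      using has_mult_order_orbit[OF _ N(2)] self_in_orbit by (auto simp: U)
    have "ord N (p ^ l) * card (orbit ` U d) = card (\<Union> (orbit ` U d))"
    proof (rule card_partition)
      show "finite (orbit ` U d)" "finite (\<Union> (orbit ` U d))" using finX[OF d] un by simp_all
      show "card c = ord N (p ^ l)" if "c \<in> orbit ` U d" for c
        using that card_orbit N by (auto simp: U)
      show "c1 \<inter> c2 = {}" if c: "c1 \<in> orbit ` U d" "c2 \<in> orbit ` U d" "c1 \<noteq> c2" for c1 c2
      proof (rule ccontr)
        assume "c1 \<inter> c2 \<noteq> {}"
        then obtain y where y: "y \<in> c1" "y \<in> c2" by blast
        obtain a b where ab: "c1 = orbit a" "c2 = orbit b" "has_mult_order a N" "has_mult_order b N"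
          using c(1,2) by (auto simp: U)
        have "orbit y = c1" "orbit y = c2"
          using y orbit_eqI[OF ab(3) N] orbit_eqI[OF ab(4) N] unfolding ab(1,2) by blast+
        then show False using c(3) by simp
      qed
    qed
    also have "\<dots> = totient N" unfolding un unfolding U by (rule card_has_mult_order[OF N])
    finally have "real (ord N (p ^ l)) * real (card (orbit ` U d)) = real (totient N)"
      by (metis of_nat_mult)
    moreover have "ord N (p ^ l) > 0"
      using coprime_card_field[OF N(2)] by simp
    ultimately show "real (card (orbit ` U d)) = real (totient (d * 2 ^ (\<nu> + 1))) / real (ord (d * 2 ^ (\<nu> + 1)) (p ^ l))"
      unfolding N_def[symmetric] by (simp add: field_simps)
  qed
  finally show ?thesis .
qed

text \<open>If \<open>1 / x\<close> is \<open>x\<close> to the power \<open>q^k\<close>, then the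
  order of \<open>x\<close> divides \<open>q^k + 1\<close>; since \<open>2 ^ (\<nu> + 1)\<close>
  divides that order, it would divide \<open>q + 1\<close>.\<close>

lemma orbit_not_self_inverse:
  assumes "\<not> 2 ^ (\<nu> + 1) dvd p ^ l + 1" "x \<in> roots"
  shows "(\<lambda>y. 1 / y) ` orbit x \<noteq> orbit x"
proof
  assume "(\<lambda>y. 1 / y) ` orbit x = orbit x"
  then have "1 / x \<in> orbit x" using self_in_orbit[of "1 / x"] orbit_inverse by simp
  then obtain k where k: "1 / x = x ^ ((p ^ l) ^ k)" by (auto simp: orbit_def)
  have "x ^ ((p ^ l) ^ k + 1) = 1 / x * x" unfolding k by simp
  also have "\<dots> = 1" using roots_nonzero[OF assms(2)] by simp
  finally have "x ^ ((p ^ l) ^ k + 1) = 1" .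
  moreover obtain d where "has_mult_order x (d * 2 ^ (\<nu> + 1))"
    using assms(2) root_iff_has_mult_order by blast
  ultimately have "2 ^ (\<nu> + 1) dvd (p ^ l) ^ k + 1"
    by (metis dvd_mult_right has_mult_order_def)
  then have "2 ^ (\<nu> + 1) dvd p ^ l + 1"
    using \<nu>_pos odd_p by (intro two_power_dvd_power_plus_1[of _ "p ^ l" k]) simp_all
  then show False using assms(1) by simp
qed

text \<open>An element of order \<open>2 ^ (\<nu> + 1)\<close> has its \<open>q\<close>-th power as
  inverse. Invariance then forces \<open>e x = p ^ r - e x\<close>, impossible since
  \<open>p ^ r\<close> is odd.\<close>

lemma no_antisymmetric_exponent_function:
  assumes "2 ^ (\<nu> + 1) dvd p ^ l + 1"
  shows "{e \<in> exponent_functions. \<forall>x\<in>roots. e (1 / x) = p ^ r - e x} = {}"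
proof (rule ccontr)
  assume "{e \<in> exponent_functions. \<forall>x\<in>roots. e (1 / x) = p ^ r - e x} \<noteq> {}"
  then obtain e where e: "e \<in> exponent_functions" "\<And>x. x \<in> roots \<Longrightarrow> e (1 / x) = p ^ r - e x"
    by blast
  \<comment> \<open>The choice is \<open>d = 1\<close>; the totient is positive, so an element of
    exactly this order exists.\<close>
  have "card {x :: 'a alg_closure. has_mult_order x (1 * 2 ^ (\<nu> + 1))} > 0"
    using card_has_mult_order[OF order_pos order_not_dvd, of 1] by simp
  then obtain x :: "'a alg_closure" where x: "has_mult_order x (1 * 2 ^ (\<nu> + 1))"
    by (auto simp: card_gt_0_iff)
  then have root: "x \<in> roots" using root_iff_has_mult_order one_dvd by blast
  have "x ^ (p ^ l + 1) = 1" using x assms unfolding has_mult_order_def mult_1 by blast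
  then have "1 / x = x ^ (p ^ l)" using roots_nonzero[OF root] by (simp add: field_simps)
  then have "e x = p ^ r - e x" "e x \<le> p ^ r"
    using e(1) e(2)[OF root] root by (auto simp: exponent_functions_def PiE_iff)
  then have "p ^ r = 2 * e x" by linarith
  then show False using odd_p by (metis dvd_triv_left even_power)
qed

end

theorem theorem3p7:
  fixes p l r \<nu> n n' :: nat
  assumes "prime p" and "odd p"
    and "card (UNIV :: 'a set) = p ^ l" and "l > 0"
    and "\<nu> > 0" and "odd n'" and "n' > 0" and "\<not> p dvd n'"
    and "n = 2 ^ \<nu> * p ^ r * n'"
  shows "real (NE TYPE('a::{field,finite}) n) =
    (if \<not> 2 ^ (\<nu> + 1) dvd p ^ l + 1
     then real (p ^ r + 1) powr
       ((\<Sum>d | d dvd n'. real (totient (d * 2 ^ (\<nu> + 1))) / real (ord (d * 2 ^ (\<nu> + 1)) (p ^ l))) / 2)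
     else 0)"
proof -
  have "\<not> p dvd 2"
    using assms by (metis dvd_refl primes_dvd_imp_eq two_is_prime_nat)
  then have "\<not> p dvd 2 ^ \<nu> * n'"
    using assms by (metis prime_dvd_mult_iff prime_dvd_power)
  \<comment> \<open>The parameter \<open>m\<close> is the part of \<open>n\<close> prime to
    \<open>p\<close>.\<close>
  then interpret negacyclic_even_length "TYPE('a)" p l r "2 ^ \<nu> * n'" n \<nu> n'
    using assms by unfold_locales simp_all
  show ?thesis
  proof (cases "2 ^ (\<nu> + 1) dvd p ^ l + 1")
    case True
    then show ?thesis
      unfolding NE_eq_card_exponent_functions no_antisymmetric_exponent_function[OF True] by simp
  next
    case False
    let ?inv = "\<lambda>s :: 'a alg_closure set. (\<lambda>y. 1 / y) ` s"
    have fin: "finite (orbit ` roots)" using finite_roots by simp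
    have inv: "?inv s \<in> orbit ` roots" "?inv (?inv s) = s" "?inv s \<noteq> s" if s: "s \<in> orbit ` roots" for s
    proof -
      obtain x where x: "x \<in> roots" "s = orbit x" using s by blast
      show "?inv s \<in> orbit ` roots" using inverse_in_roots[OF x(1)] orbit_inverse x(2) by blast
      show "?inv (?inv s) = s" by (simp add: image_image)
      show "?inv s \<noteq> s" using orbit_not_self_inverse[OF False x(1)] x(2) by simp
    qed
    obtain k where k: "card (orbit ` roots) = 2 * k"
      "card {f \<in> orbit ` roots \<rightarrow>\<^sub>E {0..p ^ r}. \<forall>s\<in>orbit ` roots. f (?inv s) = p ^ r - f s} =
        (p ^ r + 1) ^ k"
      using card_antisymmetric_functions[where i = ?inv, OF fin inv] by blast
    \<comment> \<open>The exponent is half the number of orbits; inversion pairs them, so it is the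
      natural number \<open>k\<close> and the real power is an ordinary one.\<close>
    have "(\<Sum>d | d dvd n'. real (totient (d * 2 ^ (\<nu> + 1))) / real (ord (d * 2 ^ (\<nu> + 1)) (p ^ l))) / 2 = real k"
      unfolding card_orbits[symmetric] k(1) by simp
    moreover have "NE TYPE('a) n = (p ^ r + 1) ^ k"
      by (simp only: NE_eq_card_exponent_functions card_exponent_functions k(2))
    moreover have "real (p ^ r + 1) powr real k = real ((p ^ r + 1) ^ k)"
      unfolding of_nat_power by (rule powr_realpow) (metis add_gr_0 of_nat_0_less_iff zero_less_one)
    ultimately show ?thesis
      using False by simp
  qed
qed

end
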